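(* Let $X$ be a locally compact Hausdorff space, let $A$ and $B$ be $C^*$-algebras, let $V$ be a Hilbert $A$-$B$-bimodule, and let $\mathcal V$ be a Hilbert $A$-$B$-bimodule bundle over $X$ with typical fiber $V$. Let $\mathcal V_0(X)=C_0(X,\mathcal V)$ be the Hilbert $A_0(X)$-$B_0(X)$-bimodule of continuous sections of $\mathcal V$ vanishing at infinity. Then there is an isometric bimodule isomorphism $$QM(\mathcal V_0(X))\cong C_b(X,QM(\mathcal V)),$$ where $QM(\mathcal V)$ on the right-hand side is equipped with the quasi-strict topology.
   Context: A Hilbert $A$-$B$-bimodule is both a left Hilbert $A$-module and a right Hilbert $B$-module, with commuting actions, whose inner products satisfy ${}_A\langle x,y\rangle z=x\langle y,z\rangle_B$ for all $x,y,z$. A bounded $A$- and $B$-linear operator on $V$ that is adjointable for the $B$-valued inner product has the same adjoint for the $A$-valued one; $\mathrm{End}^*_{A,B}(V)$ is the $C^*$-algebra of adjointable $A$-$B$-linear operators and $U_{A,B}(V)$ its set of unitary elements (with the norm topology). For a Hilbert $A$-$B$-bimodule $V$, $QM(V)$ is the Banach space of bounded bilinear maps $q\colon A\times B\to V$ with $q(ca,bd)=c\,q(a,b)\,d$ for $a,c\in A$, $b,d\in B$, with norm $\|q\|=\sup\{\|q(a,b)\| : \|a\|\le1,\|b\|\le1\}$ and bimodule structure $(a\lhd q)(a',b')=q(a'a,b')$, $(q\rhd b)(a',b')=q(a',bb')$. The quasi-strict topology on $QM(V)$ is the locally convex topology given by the seminorms $q\mapsto\|a\lhd q\rhd b\|$,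 $a\in A$, $b\in B$. The same definitions apply to $QM(\mathcal V_0(X))$ over the $C^*$-algebras $A_0(X)=C_0(X,A)$ and $B_0(X)=C_0(X,B)$ (continuous functions vanishing at infinity, supremum norm). A Hilbert $A$-$B$-bimodule bundle over $X$ with typical fiber $V$ is a triple $(\mathcal V,p,X)$ with $\mathcal V$ a Hausdorff space and $p\colon\mathcal V\to X$ a surjection such that: (i) there are an open cover $\{U_i\}_{i\in I}$ of $X$ and homeomorphisms $\varphi_i\colon p^{-1}(U_i)\to U_i\times V$ with $\mathrm{pr}_1\circ\varphi_i=p|_{p^{-1}(U_i)}$; (ii) if $\overline\varphi_{ij}$ is defined by $\varphi_j\circ\varphi_i^{-1}(x,v)=(x,\overline\varphi_{ij}(x)(v))$ for $x\in U_i\cap U_j$, $v\in V$, then $\overline\varphi_{ij}$ is a continuous map $U_i\cap U_j\to U_{A,B}(V)$. Each fiber thereby is a Hilbert $A$-$B$-bimodule isomorphic to $V$, and $\mathcal V_0(X)$ is a Hilbert $A_0(X)$-$B_0(X)$-bimodule with pointwise operations and pointwise inner products computed in the local trivializations, e.g. ${}_{A_0(X)}\langle\sigma,\tau\rangle(x)={}_A\langle\mathrm{pr}_2\varphi_i\sigma(x),\mathrm{pr}_2\varphi_i\tau(x)\rangle$ for $x\in U_i$ (independent of $i$), and similarly for $B_0(X)$. The bundle of quasi-multipliers is $QM(\mathcal V)=\coprod_{i\in I}U_i\times QM(V)/\sim$, where $(x,q)\in U_i\times QM(V)$ is identified with $(x,\overline\varphi_{ij}(x)\circ q)\in U_j\times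 QM(V)$ for $x\in U_i\cap U_j$. The quasi-strict topology on $QM(\mathcal V)$ is the quotient topology obtained when $QM(V)$ carries the quasi-strict topology. The fiber over $x$ is canonically $QM(\mathcal V_x)$, where $\mathcal V_x=p^{-1}(x)$, and has its operator norm. $C_b(X,QM(\mathcal V))$ is the space of bounded sections $F$ of $QM(\mathcal V)$ that are continuous for the quasi-strict topology, with norm $\|F\|=\sup_{x\in X}\|F(x)\|$ and the pointwise $A_0(X)$-$B_0(X)$-bimodule structure $(\alpha\lhd F\rhd\beta)(x)=\alpha(x)\lhd F(x)\rhd\beta(x)$; "bimodule isomorphism" refers to these $A_0(X)$-$B_0(X)$-bimodule structures. *)

theory Defs
  imports "HOL-Analysis.Analysis"
begin

section \<open>C*-algebras\<close>

class complex_banach = banach +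
  fixes scaleC :: "complex \<Rightarrow> 'a \<Rightarrow> 'a"  (infixr "*\<^sub>C" 75)
  assumes scaleC_add_right: "c *\<^sub>C (x + y) = c *\<^sub>C x + c *\<^sub>C y"
    and scaleC_add_left: "(c + d) *\<^sub>C x = c *\<^sub>C x + d *\<^sub>C x"
    and scaleC_scaleC: "c *\<^sub>C d *\<^sub>C x = (c * d) *\<^sub>C x"
    and scaleC_of_real: "complex_of_real r *\<^sub>C x = r *\<^sub>R x"
    and norm_scaleC: "norm (c *\<^sub>C x) = cmod c * norm x"

text \<open>No unit is required, and the zero algebra is allowed.\<close>

class cstar_algebra = complex_banach + real_normed_algebra +
  fixes cstar :: "'a \<Rightarrow> 'a"
  assumes mult_scaleC_left: "(c *\<^sub>C x) * y = c *\<^sub>C (x * y)"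
    and mult_scaleC_right: "x * (c *\<^sub>C y) = c *\<^sub>C (x * y)"
    and cstar_cstar: "cstar (cstar x) = x"
    and cstar_add: "cstar (x + y) = cstar x + cstar y"
    and cstar_scaleC: "cstar (c *\<^sub>C x) = cnj c *\<^sub>C cstar x"
    and cstar_mult: "cstar (x * y) = cstar y * cstar x"
    and norm_cstar_mult: "norm (cstar x * x) = (norm x)\<^sup>2"

definition cstar_positive :: "'a::cstar_algebra \<Rightarrow> bool" where
  "cstar_positive a \<longleftrightarrow> (\<exists>c. a = cstar c * c)"

section \<open>Algebras and bimodules on explicit carriers\<close>

text \<open>
  The given algebras and the typical fibre are types, but the fibres of a bundle and the spaces of
  functions and sections are not; so quasi-multipliers are defined for structures with an explicit
  carrier.  Maps are extensional, i.e. \<open>undefined\<close> outside their domain.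
\<close>

record 'v cnormed_space =
  carrier :: "'v set"
  add :: "'v \<Rightarrow> 'v \<Rightarrow> 'v"
  scl :: "complex \<Rightarrow> 'v \<Rightarrow> 'v"
  nrm :: "'v \<Rightarrow> real"

record 'a star_algebra = "'a cnormed_space" +
  mul :: "'a \<Rightarrow> 'a \<Rightarrow> 'a"
  adj :: "'a \<Rightarrow> 'a"

record ('a, 'b, 'v) bimodule = "'v cnormed_space" +
  lact :: "'a \<Rightarrow> 'v \<Rightarrow> 'v"
  ract :: "'v \<Rightarrow> 'b \<Rightarrow> 'v"

record ('a, 'b, 'v) hbimodule = "('a, 'b, 'v) bimodule" +
  lip :: "'v \<Rightarrow> 'v \<Rightarrow> 'a"
  rip :: "'v \<Rightarrow> 'v \<Rightarrow> 'b"

definition type_algebra :: "'a::cstar_algebra star_algebra" where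
  "type_algebra = \<lparr>carrier = UNIV, add = (+), scl = (*\<^sub>C), nrm = norm, mul = (*), adj = cstar\<rparr>"

section \<open>Hilbert bimodules\<close>

locale hilbert_bimodule =
  fixes V :: "('a::cstar_algebra, 'b::cstar_algebra, 'v::complex_banach) hbimodule"
  assumes carrier_V: "carrier V = UNIV"
    and add_V: "add V = (+)"
    and scl_V: "scl V = (*\<^sub>C)"
    and nrm_V: "nrm V = norm"
    and lact_add_left: "lact V (a + a') v = lact V a v + lact V a' v"
    and lact_add_right: "lact V a (v + w) = lact V a v + lact V a w"
    and lact_scaleC_left: "lact V (c *\<^sub>C a) v = c *\<^sub>C lact V a v"
    and lact_scaleC_right: "lact V a (c *\<^sub>C v) = c *\<^sub>C lact V a v"
    and lact_mult: "lact V (a * a') v = lact V a (lact V a' v)"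
    and ract_add_left: "ract V (v + w) b = ract V v b + ract V w b"
    and ract_add_right: "ract V v (b + b') = ract V v b + ract V v b'"
    and ract_scaleC_left: "ract V (c *\<^sub>C v) b = c *\<^sub>C ract V v b"
    and ract_scaleC_right: "ract V v (c *\<^sub>C b) = c *\<^sub>C ract V v b"
    and ract_mult: "ract V v (b * b') = ract V (ract V v b) b'"
    and actions_commute: "ract V (lact V a v) b = lact V a (ract V v b)"
    and lip_add: "lip V (v + v') w = lip V v w + lip V v' w"
    and lip_scaleC: "lip V (c *\<^sub>C v) w = c *\<^sub>C lip V v w"
    and lip_lact: "lip V (lact V a v) w = a * lip V v w"
    and lip_cstar: "cstar (lip V v w) = lip V w v"
    and lip_positive: "cstar_positive (lip V v v)"
    and norm_lip: "norm v = sqrt (norm (lip V v v))"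
    and rip_add: "rip V v (w + w') = rip V v w + rip V v w'"
    and rip_scaleC: "rip V v (c *\<^sub>C w) = c *\<^sub>C rip V v w"
    and rip_ract: "rip V v (ract V w b) = rip V v w * b"
    and rip_cstar: "cstar (rip V v w) = rip V w v"
    and rip_positive: "cstar_positive (rip V v v)"
    and norm_rip: "norm v = sqrt (norm (rip V v v))"
    and lip_rip: "lact V (lip V v w) z = ract V v (rip V w z)"

definition adjointable_bimodule_maps ::
    "('a::cstar_algebra, 'b::cstar_algebra, 'v::complex_banach) hbimodule \<Rightarrow> ('v \<Rightarrow>\<^sub>L 'v) set" where
  "adjointable_bimodule_maps V = {T :: 'v \<Rightarrow>\<^sub>L 'v.
     (\<forall>c v. T (c *\<^sub>C v) = c *\<^sub>C T v) \<and>
     (\<forall>a v. T (lact V a v) = lact V a (T v)) \<and>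
     (\<forall>v b. T (ract V v b) = ract V (T v) b) \<and>
     (\<exists>S :: 'v \<Rightarrow>\<^sub>L 'v. \<forall>v w. rip V (T v) w = rip V v (S w))}"

definition unitary_bimodule_maps ::
    "('a::cstar_algebra, 'b::cstar_algebra, 'v::complex_banach) hbimodule \<Rightarrow> ('v \<Rightarrow>\<^sub>L 'v) set" where
  "unitary_bimodule_maps V = {T :: 'v \<Rightarrow>\<^sub>L 'v. T \<in> adjointable_bimodule_maps V \<and>
     (\<exists>S :: 'v \<Rightarrow>\<^sub>L 'v. S \<in> adjointable_bimodule_maps V \<and>
       (\<forall>v w. rip V (T v) w = rip V v (S w)) \<and>
       S o\<^sub>L T = id_blinfun \<and> T o\<^sub>L S = id_blinfun)}"

section \<open>Quasi-multipliers\<close>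

definition quasi_multipliers ::
    "('a, 'm) star_algebra_scheme \<Rightarrow> ('b, 'n) star_algebra_scheme \<Rightarrow>
     ('a, 'b, 'v, 'z) bimodule_scheme \<Rightarrow> ('a \<times> 'b \<Rightarrow> 'v) set" where
  "quasi_multipliers A B V = {q \<in> carrier A \<times> carrier B \<rightarrow>\<^sub>E carrier V.
     (\<forall>a\<in>carrier A. \<forall>a'\<in>carrier A. \<forall>b\<in>carrier B.
        q (add A a a', b) = add V (q (a, b)) (q (a', b))) \<and>
     (\<forall>a\<in>carrier A. \<forall>b\<in>carrier B. \<forall>b'\<in>carrier B.
        q (a, add B b b') = add V (q (a, b)) (q (a, b'))) \<and>
     (\<forall>c. \<forall>a\<in>carrier A. \<forall>b\<in>carrier B. q (scl A c a, b) = scl V c (q (a, b))) \<and>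
     (\<forall>c. \<forall>a\<in>carrier A. \<forall>b\<in>carrier B. q (a, scl B c b) = scl V c (q (a, b))) \<and>
     (\<exists>K. \<forall>a\<in>carrier A. \<forall>b\<in>carrier B. nrm V (q (a, b)) \<le> K * nrm A a * nrm B b) \<and>
     (\<forall>a\<in>carrier A. \<forall>c\<in>carrier A. \<forall>b\<in>carrier B. \<forall>d\<in>carrier B.
        q (mul A c a, mul B b d) = lact V c (ract V (q (a, b)) d))}"

definition QM ::
    "('a, 'm) star_algebra_scheme \<Rightarrow> ('b, 'n) star_algebra_scheme \<Rightarrow>
     ('a, 'b, 'v, 'z) bimodule_scheme \<Rightarrow> ('a, 'b, 'a \<times> 'b \<Rightarrow> 'v) bimodule" where
  "QM A B V = \<lparr>
     carrier = quasi_multipliers A B V,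
     add = (\<lambda>q r. \<lambda>(a, b) \<in> carrier A \<times> carrier B. add V (q (a, b)) (r (a, b))),
     scl = (\<lambda>c q. \<lambda>(a, b) \<in> carrier A \<times> carrier B. scl V c (q (a, b))),
     nrm = (\<lambda>q. Sup {nrm V (q (a, b)) | a b.
              a \<in> carrier A \<and> b \<in> carrier B \<and> nrm A a \<le> 1 \<and> nrm B b \<le> 1}),
     lact = (\<lambda>a q. \<lambda>(a', b') \<in> carrier A \<times> carrier B. q (mul A a' a, b')),
     ract = (\<lambda>q b. \<lambda>(a', b') \<in> carrier A \<times> carrier B. q (a', mul B b b'))\<rparr>"

text \<open>
  The coarsest topology making all seminorm balls
  \<open>{r. \<parallel>a \<lhd> (r - q) \<rhd> b\<parallel> < \<epsilon>}\<close> open.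
\<close>

definition quasi_strict_topology ::
    "('a, 'm) star_algebra_scheme \<Rightarrow> ('b, 'n) star_algebra_scheme \<Rightarrow>
     ('a, 'b, 'v, 'z) bimodule_scheme \<Rightarrow> ('a \<times> 'b \<Rightarrow> 'v) topology" where
  "quasi_strict_topology A B V = (let M = QM A B V in
     topology_generated_by
       {{r \<in> carrier M. nrm M (ract M (lact M a (add M r (scl M (-1) q))) b) < \<epsilon>} | a b q \<epsilon>.
          a \<in> carrier A \<and> b \<in> carrier B \<and> q \<in> carrier M \<and> 0 < \<epsilon>})"

section \<open>Bundles of Hilbert bimodules\<close>

text \<open>\<open>nbhd i\<close> and \<open>triv i\<close>, for \<open>i\<close> in \<open>chart_index\<close>, are the trivialising cover and the charts.\<close>

record ('i, 'x, 'e, 'v) fibre_bundle =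
  base_space :: "'x topology"
  total_space :: "'e topology"
  projection :: "'e \<Rightarrow> 'x"
  chart_index :: "'i set"
  nbhd :: "'i \<Rightarrow> 'x set"
  triv :: "'i \<Rightarrow> 'e \<Rightarrow> 'x \<times> 'v"

definition triv_inv :: "('i, 'x, 'e, 'v) fibre_bundle \<Rightarrow> 'i \<Rightarrow> 'x \<times> 'v \<Rightarrow> 'e" where
  "triv_inv E i = inv_into {e \<in> topspace (total_space E). projection E e \<in> nbhd E i} (triv E i)"

definition transition :: "('i, 'x, 'e, 'v) fibre_bundle \<Rightarrow> 'i \<Rightarrow> 'i \<Rightarrow> 'x \<Rightarrow> 'v \<Rightarrow> 'v" where
  "transition E i j x v = snd (triv E j (triv_inv E i (x, v)))"

locale hilbert_bimodule_bundle = hilbert_bimodule V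
  for V :: "('a::cstar_algebra, 'b::cstar_algebra, 'v::complex_banach) hbimodule" +
  fixes E :: "('i, 'x, 'e, 'v) fibre_bundle"
  assumes Hausdorff_total: "Hausdorff_space (total_space E)"
    and proj_surj: "projection E ` topspace (total_space E) = topspace (base_space E)"
    and open_nbhd: "i \<in> chart_index E \<Longrightarrow> openin (base_space E) (nbhd E i)"
    and cover: "(\<Union>i\<in>chart_index E. nbhd E i) = topspace (base_space E)"
    and homeo_triv: "i \<in> chart_index E \<Longrightarrow>
       homeomorphic_map
         (subtopology (total_space E) {e \<in> topspace (total_space E). projection E e \<in> nbhd E i})
         (prod_topology (subtopology (base_space E) (nbhd E i)) euclidean)
         (triv E i)"
    and fst_triv: "\<lbrakk>i \<in> chart_index E; e \<in> topspace (total_space E); projection E e \<in> nbhd E i\<rbrakk>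
       \<Longrightarrow> fst (triv E i e) = projection E e"
    and transition_unitary: "\<lbrakk>i \<in> chart_index E; j \<in> chart_index E\<rbrakk> \<Longrightarrow>
       \<exists>T. continuous_map (subtopology (base_space E) (nbhd E i \<inter> nbhd E j))
             (top_of_set (unitary_bimodule_maps V)) T \<and>
           (\<forall>x \<in> nbhd E i \<inter> nbhd E j. transition E i j x = blinfun_apply (T x))"

text \<open>
  The Hilbert bimodule structure of a fibre is transported from \<open>V\<close> along a chart; as the transition
  maps are unitary and bilinear, the choice of the chart does not matter.
\<close>

definition chart_at :: "('i, 'x, 'e, 'v) fibre_bundle \<Rightarrow> 'x \<Rightarrow> 'i" where
  "chart_at E x = (SOME i. i \<in> chart_index E \<and> x \<in> nbhd E i)"

definition fibre ::
    "('a, 'b, 'v) hbimodule \<Rightarrow> ('i, 'x, 'e, 'v) fibre_bundle \<Rightarrow> 'x \<Rightarrow> ('a, 'b, 'e) hbimodule" where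
  "fibre V E x =
    (let f = (\<lambda>e. snd (triv E (chart_at E x) e));
         g = (\<lambda>v. triv_inv E (chart_at E x) (x, v))
     in \<lparr>carrier = {e \<in> topspace (total_space E). projection E e = x},
         add = (\<lambda>e e'. g (add V (f e) (f e'))),
         scl = (\<lambda>c e. g (scl V c (f e))),
         nrm = (\<lambda>e. nrm V (f e)),
         lact = (\<lambda>a e. g (lact V a (f e))),
         ract = (\<lambda>e b. g (ract V (f e) b)),
         lip = (\<lambda>e e'. lip V (f e) (f e')),
         rip = (\<lambda>e e'. rip V (f e) (f e'))\<rparr>)"

section \<open>Functions and sections vanishing at infinity\<close>

definition vanishes_at_infinity :: "'x topology \<Rightarrow> ('x \<Rightarrow> real) \<Rightarrow> bool" where
  "vanishes_at_infinity X h \<longleftrightarrow>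
     (\<forall>\<epsilon>>0. \<exists>K. compactin X K \<and> (\<forall>x \<in> topspace X - K. \<bar>h x\<bar> < \<epsilon>))"

text \<open>Inserting \<open>0\<close> gives the supremum the value \<open>0\<close> over the empty space.\<close>

definition sup_over :: "'x topology \<Rightarrow> ('x \<Rightarrow> real) \<Rightarrow> real" where
  "sup_over X h = Sup (insert 0 (h ` topspace X))"

definition C0 :: "'x topology \<Rightarrow> ('x \<Rightarrow> 'a::cstar_algebra) star_algebra" where
  "C0 X = \<lparr>
     carrier = {f \<in> extensional (topspace X).
       continuous_map X euclidean f \<and> vanishes_at_infinity X (\<lambda>x. norm (f x))},
     add = (\<lambda>f g. \<lambda>x \<in> topspace X. f x + g x),
     scl = (\<lambda>c f. \<lambda>x \<in> topspace X. c *\<^sub>C f x),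
     nrm = (\<lambda>f. sup_over X (\<lambda>x. norm (f x))),
     mul = (\<lambda>f g. \<lambda>x \<in> topspace X. f x * g x),
     adj = (\<lambda>f. \<lambda>x \<in> topspace X. cstar (f x))\<rparr>"

definition C0_sections ::
    "('a::cstar_algebra, 'b::cstar_algebra, 'v) hbimodule \<Rightarrow> ('i, 'x, 'e, 'v) fibre_bundle \<Rightarrow>
     ('x \<Rightarrow> 'a, 'x \<Rightarrow> 'b, 'x \<Rightarrow> 'e) hbimodule" where
  "C0_sections V E =
    (let X = base_space E;
         right_product = (\<lambda>\<sigma> \<tau>. \<lambda>x \<in> topspace X. rip (fibre V E x) (\<sigma> x) (\<tau> x))
     in \<lparr>carrier = {\<sigma> \<in> extensional (topspace X).
           continuous_map X (total_space E) \<sigma> \<and>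
           (\<forall>x \<in> topspace X. projection E (\<sigma> x) = x) \<and>
           vanishes_at_infinity X (\<lambda>x. nrm (fibre V E x) (\<sigma> x))},
         add = (\<lambda>\<sigma> \<tau>. \<lambda>x \<in> topspace X. add (fibre V E x) (\<sigma> x) (\<tau> x)),
         scl = (\<lambda>c \<sigma>. \<lambda>x \<in> topspace X. scl (fibre V E x) c (\<sigma> x)),
         nrm = (\<lambda>\<sigma>. sqrt (nrm (C0 X) (right_product \<sigma> \<sigma>))),
         lact = (\<lambda>\<alpha> \<sigma>. \<lambda>x \<in> topspace X. lact (fibre V E x) (\<alpha> x) (\<sigma> x)),
         ract = (\<lambda>\<sigma> \<beta>. \<lambda>x \<in> topspace X. ract (fibre V E x) (\<sigma> x) (\<beta> x)),
         lip = (\<lambda>\<sigma> \<tau>. \<lambda>x \<in> topspace X. lip (fibre V E x) (\<sigma> x) (\<tau> x)),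
         rip = right_product\<rparr>)"

section \<open>The bundle of quasi-multipliers\<close>

text \<open>
  The quotient topology is written with the preimage under \<open>z \<mapsto> r `` {z}\<close>, so that it is a topology
  for any relation \<open>r\<close>.
\<close>

definition quotient_topology :: "'z topology \<Rightarrow> ('z \<times> 'z) set \<Rightarrow> 'z set topology" where
  "quotient_topology Z r =
     topology (\<lambda>W. W \<subseteq> topspace Z // r \<and> openin Z {z \<in> topspace Z. r `` {z} \<in> W})"

lemma openin_quotient_topology:
  "openin (quotient_topology Z r) W \<longleftrightarrow>
     W \<subseteq> topspace Z // r \<and> openin Z {z \<in> topspace Z. r `` {z} \<in> W}"
proof -
  have "istopology (\<lambda>W. W \<subseteq> topspace Z // r \<and> openin Z {z \<in> topspace Z. r `` {z} \<in> W})"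
    unfolding istopology_def
  proof (intro conjI allI impI)
    fix S T
    assume S: "S \<subseteq> topspace Z // r \<and> openin Z {z \<in> topspace Z. r `` {z} \<in> S}"
      and T: "T \<subseteq> topspace Z // r \<and> openin Z {z \<in> topspace Z. r `` {z} \<in> T}"
    then show "S \<inter> T \<subseteq> topspace Z // r" by blast
    have "{z \<in> topspace Z. r `` {z} \<in> S \<inter> T} =
      {z \<in> topspace Z. r `` {z} \<in> S} \<inter> {z \<in> topspace Z. r `` {z} \<in> T}" by blast
    then show "openin Z {z \<in> topspace Z. r `` {z} \<in> S \<inter> T}"
      using S T by (simp add: openin_Int)
  next
    fix \<K>
    assume K: "\<forall>K\<in>\<K>. K \<subseteq> topspace Z // r \<and> openin Z {z \<in> topspace Z. r `` {z} \<in> K}"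
    then show "\<Union>\<K> \<subseteq> topspace Z // r" by blast
    have "{z \<in> topspace Z. r `` {z} \<in> \<Union>\<K>} = (\<Union>K\<in>\<K>. {z \<in> topspace Z. r `` {z} \<in> K})"
      by blast
    then show "openin Z {z \<in> topspace Z. r `` {z} \<in> \<Union>\<K>}"
      using K by auto
  qed
  then show ?thesis
    by (simp add: quotient_topology_def)
qed

definition QM_coproduct ::
    "('a::cstar_algebra, 'b::cstar_algebra, 'v) hbimodule \<Rightarrow> ('i, 'x, 'e, 'v) fibre_bundle \<Rightarrow>
     ('i \<times> 'x \<times> ('a \<times> 'b \<Rightarrow> 'v)) topology" where
  "QM_coproduct V E =
     sum_topology
       (\<lambda>i. prod_topology (subtopology (base_space E) (nbhd E i))
              (quasi_strict_topology type_algebra type_algebra V))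
       (chart_index E)"

definition QM_glue ::
    "('a::cstar_algebra, 'b::cstar_algebra, 'v) hbimodule \<Rightarrow> ('i, 'x, 'e, 'v) fibre_bundle \<Rightarrow>
     (('i \<times> 'x \<times> ('a \<times> 'b \<Rightarrow> 'v)) \<times> ('i \<times> 'x \<times> ('a \<times> 'b \<Rightarrow> 'v))) set" where
  "QM_glue V E = {((i, x, q), (j, x, transition E i j x \<circ> q)) | i j x q.
     i \<in> chart_index E \<and> j \<in> chart_index E \<and> x \<in> nbhd E i \<inter> nbhd E j \<and>
     q \<in> quasi_multipliers type_algebra type_algebra V}"

definition QM_bundle ::
    "('a::cstar_algebra, 'b::cstar_algebra, 'v) hbimodule \<Rightarrow> ('i, 'x, 'e, 'v) fibre_bundle \<Rightarrow>
     ('i \<times> 'x \<times> ('a \<times> 'b \<Rightarrow> 'v)) set topology" where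
  "QM_bundle V E = quotient_topology (QM_coproduct V E) (QM_glue V E)"

text \<open>
  The canonical map from the fibre of \<open>QM_bundle V E\<close> over \<open>x\<close> to the quasi-multipliers of the
  fibre of \<open>E\<close> over \<open>x\<close>: the class of \<open>(i, x, q)\<close> goes to \<open>q\<close> followed by the inverse of the
  \<open>i\<close>-th chart at \<open>x\<close>.
\<close>

definition QM_fibre_carrier ::
    "('a::cstar_algebra, 'b::cstar_algebra, 'v) hbimodule \<Rightarrow> ('i, 'x, 'e, 'v) fibre_bundle \<Rightarrow> 'x \<Rightarrow>
     ('i \<times> 'x \<times> ('a \<times> 'b \<Rightarrow> 'v)) set set" where
  "QM_fibre_carrier V E x = {c \<in> topspace (QM_bundle V E). \<exists>i q. (i, x, q) \<in> c}"

definition QM_fibre_canonical ::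
    "('i, 'x, 'e, 'v) fibre_bundle \<Rightarrow> 'x \<Rightarrow> ('i \<times> 'x \<times> ('a \<times> 'b \<Rightarrow> 'v)) set \<Rightarrow> 'a \<times> 'b \<Rightarrow> 'e" where
  "QM_fibre_canonical E x c =
     (THE Q. \<exists>i q. (i, x, q) \<in> c \<and> Q = (\<lambda>(a, b). triv_inv E i (x, q (a, b))))"

definition QM_fibre ::
    "('a::cstar_algebra, 'b::cstar_algebra, 'v) hbimodule \<Rightarrow> ('i, 'x, 'e, 'v) fibre_bundle \<Rightarrow> 'x \<Rightarrow>
     ('a, 'b, ('i \<times> 'x \<times> ('a \<times> 'b \<Rightarrow> 'v)) set) bimodule" where
  "QM_fibre V E x =
    (let M = QM type_algebra type_algebra (fibre V E x);
         f = QM_fibre_canonical E x;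
         g = inv_into (QM_fibre_carrier V E x) f
     in \<lparr>carrier = QM_fibre_carrier V E x,
         add = (\<lambda>c d. g (add M (f c) (f d))),
         scl = (\<lambda>z c. g (scl M z (f c))),
         nrm = (\<lambda>c. nrm M (f c)),
         lact = (\<lambda>a c. g (lact M a (f c))),
         ract = (\<lambda>c b. g (ract M (f c) b))\<rparr>)"

definition Cb_QM_sections ::
    "('a::cstar_algebra, 'b::cstar_algebra, 'v) hbimodule \<Rightarrow> ('i, 'x, 'e, 'v) fibre_bundle \<Rightarrow>
     ('x \<Rightarrow> 'a, 'x \<Rightarrow> 'b, 'x \<Rightarrow> ('i \<times> 'x \<times> ('a \<times> 'b \<Rightarrow> 'v)) set) bimodule" where
  "Cb_QM_sections V E =
    (let X = base_space E
     in \<lparr>carrier = {F \<in> extensional (topspace X).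
           continuous_map X (QM_bundle V E) F \<and>
           (\<forall>x \<in> topspace X. F x \<in> carrier (QM_fibre V E x)) \<and>
           (\<exists>K. \<forall>x \<in> topspace X. nrm (QM_fibre V E x) (F x) \<le> K)},
         add = (\<lambda>F G. \<lambda>x \<in> topspace X. add (QM_fibre V E x) (F x) (G x)),
         scl = (\<lambda>c F. \<lambda>x \<in> topspace X. scl (QM_fibre V E x) c (F x)),
         nrm = (\<lambda>F. sup_over X (\<lambda>x. nrm (QM_fibre V E x) (F x))),
         lact = (\<lambda>\<alpha> F. \<lambda>x \<in> topspace X. lact (QM_fibre V E x) (\<alpha> x) (F x)),
         ract = (\<lambda>F \<beta>. \<lambda>x \<in> topspace X. ract (QM_fibre V E x) (F x) (\<beta> x))\<rparr>)"

section \<open>Isometric isomorphisms of bimodules\<close>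

definition isometric_bimodule_iso ::
    "('a, 'm) star_algebra_scheme \<Rightarrow> ('b, 'n) star_algebra_scheme \<Rightarrow>
     ('a, 'b, 'v, 'y) bimodule_scheme \<Rightarrow> ('a, 'b, 'w, 'z) bimodule_scheme \<Rightarrow> ('v \<Rightarrow> 'w) \<Rightarrow> bool" where
  "isometric_bimodule_iso A B M N \<Phi> \<longleftrightarrow>
     bij_betw \<Phi> (carrier M) (carrier N) \<and>
     (\<forall>m\<in>carrier M. \<forall>m'\<in>carrier M. \<Phi> (add M m m') = add N (\<Phi> m) (\<Phi> m')) \<and>
     (\<forall>c. \<forall>m\<in>carrier M. \<Phi> (scl M c m) = scl N c (\<Phi> m)) \<and>
     (\<forall>m\<in>carrier M. nrm N (\<Phi> m) = nrm M m) \<and>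
     (\<forall>a\<in>carrier A. \<forall>m\<in>carrier M. \<Phi> (lact M a m) = lact N a (\<Phi> m)) \<and>
     (\<forall>b\<in>carrier B. \<forall>m\<in>carrier M. \<Phi> (ract M m b) = ract N (\<Phi> m) b)"

end

theory Submission
  imports Defs
begin

text \<open>
  A quasi-multiplier \<open>q\<close> of the module \<open>V\<^sub>0\<close> of sections acts fibrewise: the vector
  \<open>q(\<alpha>, \<beta>)(x)\<close> depends only on \<open>\<alpha>(x)\<close> and \<open>\<beta>(x)\<close>.  Hence \<open>q\<close> is the same thing as
  a bounded family of quasi-multipliers \<open>q\<^sub>x\<close> of the fibres, and the isomorphism sends \<open>q\<close>
  to \<open>x \<mapsto> q\<^sub>x\<close>.

  Fibrewise action rests on the commutation with bounded scalar functions,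
  \<open>q(\<phi>\<alpha>, \<psi>\<beta>) = \<phi>\<psi> q(\<alpha>, \<beta>)\<close> (\<open>val_scaleR\<close>).  After multiplication by
  \<open>\<gamma>\<close> from the left and by \<open>\<delta>\<close> from the right, both sides of this identity agree, because
  \<open>\<gamma>(\<phi>\<alpha>) = (\<phi>\<gamma>)\<alpha>\<close>; and a vector \<open>v\<close> of a Hilbert bimodule is determined by all
  \<open>c v d\<close>, since \<open>\<langle>v, v\<rangle> v = 0\<close> forces \<open>v = 0\<close>.  If \<open>\<alpha>(x) = 0\<close>, choose \<open>\<phi>\<close> with
  \<open>\<phi>(x) = 1\<close> and \<open>\<parallel>\<phi>\<alpha>\<parallel>\<close> small; boundedness of \<open>q\<close> gives
  \<open>q(\<alpha>, \<beta>)(x) = 0\<close> (\<open>val_eq_zero\<close>), and bilinearity does the rest.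

  The continuity conditions on the two sides match because the quasi-strict topology on \<open>QM(V)\<close> is
  the initial topology for the evaluations \<open>q \<mapsto> q(a, b)\<close>
  (\<open>continuous_map_quasi_strict_iff\<close>).  Indeed \<open>a \<lhd> q \<rhd> b\<close> takes the values
  \<open>a' q(a, b) b'\<close>, and its norm is exactly \<open>\<parallel>q(a, b)\<parallel>\<close>, as
  \<open>\<parallel>a' v\<parallel> = \<parallel>v\<parallel>\<close> for \<open>a' = \<langle>v, v\<rangle> / \<parallel>v\<parallel>\<^sup>2\<close>.  The transition maps are norm
  continuous, so the evaluations in a chart descend to the quotient \<open>QM_bundle V E\<close>, and a section
  \<open>F\<close> of it is continuous exactly if all the sections \<open>x \<mapsto> F(x)(a, b)\<close> of \<open>E\<close> are
  (\<open>continuous_map_QM_section_iff\<close>).  For \<open>F = (q\<^sub>x)\<close> these sections are locally of the form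
  \<open>q(\<alpha>, \<beta>)\<close>.  Conversely, a bounded family that is continuous at fixed \<open>(a, b)\<close> gives
  continuous sections \<open>x \<mapsto> q\<^sub>x(\<alpha>(x), \<beta>(x))\<close> (\<open>continuous_section_eval\<close>).  Both sides
  are thus parametrised by the same set \<open>QM_families\<close>, on which the operations are pointwise and
  both norms are the supremum of the fibre norms (\<open>nrm_qm_of\<close>).
\<close>

section \<open>Algebra and norms in C*-algebras and Hilbert bimodules\<close>

lemma scaleR_eq_scaleC: "r *\<^sub>R x = complex_of_real r *\<^sub>C x" for x :: "'a::complex_banach"
  by (simp add: scaleC_of_real)

lemma scaleC_minus1 [simp]: "(-1) *\<^sub>C x = - x" for x :: "'a::complex_banach"
  using scaleR_eq_scaleC[of "-1" x] by simp

lemma scaleC_commute: "c *\<^sub>C d *\<^sub>C x = d *\<^sub>C c *\<^sub>C x" for x :: "'a::complex_banach"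
  by (simp add: scaleC_scaleC mult.commute)

lemma scaleC_scaleR_commute: "c *\<^sub>C r *\<^sub>R x = r *\<^sub>R c *\<^sub>C x" for x :: "'a::complex_banach"
  by (simp only: scaleR_eq_scaleC scaleC_commute[of c])

lemma scaleC_tendsto:
  fixes f :: "'z \<Rightarrow> 'a::complex_banach"
  assumes "(f \<longlongrightarrow> l) F"
  shows "((\<lambda>z. c *\<^sub>C f z) \<longlongrightarrow> c *\<^sub>C l) F"
proof -
  have "bounded_linear ((*\<^sub>C) c :: 'a \<Rightarrow> 'a)"
    by (intro bounded_linear_intro[where K = "cmod c"])
      (simp_all add: scaleC_add_right scaleC_scaleR_commute norm_scaleC)
  then show ?thesis
    using assms by (rule bounded_linear.tendsto)
qed

lemma norm_cstar [simp]: "norm (cstar x) = norm x" for x :: "'a::cstar_algebra"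
proof -
  have le: "norm y \<le> norm (cstar y)" for y :: 'a
  proof (cases "y = 0")
    case False
    have "norm y * norm y \<le> norm (cstar y) * norm y"
      using norm_mult_ineq[of "cstar y" y] by (simp add: norm_cstar_mult power2_eq_square)
    with False show ?thesis by simp
  qed simp
  from le[of x] le[of "cstar x"] show ?thesis by (simp add: cstar_cstar)
qed

lemma norm_self_adjoint_square:
  fixes h :: "'a::cstar_algebra"
  assumes "cstar h = h"
  shows "norm (h * h) = (norm h)\<^sup>2"
  using norm_cstar_mult[of h] assms by simp

text \<open>
  The lower bound comes from \<open>\<parallel>h\<parallel>\<^sup>4 = \<parallel>h\<^sup>4\<parallel> \<le> \<parallel>h\<^sup>3\<parallel> \<parallel>h\<parallel>\<close>.
\<close>

lemma norm_self_adjoint_cube: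
  fixes h :: "'a::cstar_algebra"
  assumes h: "cstar h = h"
  shows "norm (h * h * h) = norm h ^ 3"
proof (cases "h = 0")
  case False
  have sq: "norm (h * h) = (norm h)\<^sup>2"
    by (rule norm_self_adjoint_square[OF h])
  have "norm (h * h * h) \<le> norm (h * h) * norm h"
    by (rule norm_mult_ineq)
  then have le: "norm (h * h * h) \<le> norm h ^ 3"
    by (simp add: sq power3_eq_cube power2_eq_square)
  have "norm ((h * h) * (h * h)) = (norm h)\<^sup>2 * (norm h)\<^sup>2"
    using norm_self_adjoint_square[of "h * h"] by (simp add: sq cstar_mult h power2_eq_square)
  moreover have "norm ((h * h) * (h * h)) \<le> norm (h * h * h) * norm h"
    using norm_mult_ineq[of "h * h * h" h] by (simp add: mult.assoc)
  ultimately have "norm h ^ 3 * norm h \<le> norm (h * h * h) * norm h"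
    by (simp add: power3_eq_cube power2_eq_square mult_ac)
  with False le show ?thesis by simp
qed simp

lemma type_algebra_simps [simp]:
  "carrier type_algebra = UNIV" "add type_algebra = (+)" "scl type_algebra = (*\<^sub>C)"
  "nrm type_algebra = norm" "mul type_algebra = (*)"
  by (simp_all add: type_algebra_def)

context hilbert_bimodule
begin

lemma lact_zero [simp]: "lact V 0 v = 0" "lact V a 0 = 0"
  using lact_add_left[of 0 0 v] lact_add_right[of a 0 0] by simp_all

lemma ract_zero [simp]: "ract V 0 b = 0" "ract V v 0 = 0"
  using ract_add_left[of 0 0 b] ract_add_right[of v 0 0] by simp_all

lemma lact_diff: "lact V a (v - w) = lact V a v - lact V a w"
  using lact_add_right[of a "v - w" w] by (simp add: algebra_simps)

lemma ract_diff: "ract V (v - w) b = ract V v b - ract V w b"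
  using ract_add_left[of "v - w" w b] by (simp add: algebra_simps)

lemma lip_lact_lact: "lip V (lact V a v) (lact V c w) = a * lip V v w * cstar c"
proof -
  have "lip V v (lact V c w) = lip V v w * cstar c"
    using lip_cstar[of "lact V c w" v] lip_cstar[of w v] by (simp add: lip_lact cstar_mult)
  then show ?thesis by (simp add: lip_lact mult.assoc)
qed

lemma rip_ract_ract: "rip V (ract V v a) (ract V w b) = cstar a * rip V v w * b"
proof -
  have "rip V (ract V v a) w = cstar a * rip V v w"
    using rip_cstar[of w "ract V v a"] rip_cstar[of w v] by (simp add: rip_ract cstar_mult)
  then show ?thesis by (simp add: rip_ract)
qed

lemma norm_lip_self: "norm (lip V v v) = (norm v)\<^sup>2"
  by (simp add: norm_lip[of v])

lemma norm_rip_self: "norm (rip V v v) = (norm v)\<^sup>2"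
  by (simp add: norm_rip[of v])

lemma norm_lact_le: "norm (lact V a v) \<le> norm a * norm v"
proof -
  have "(norm (lact V a v))\<^sup>2 = norm (a * lip V v v * cstar a)"
    by (simp add: norm_lip_self[symmetric] lip_lact_lact)
  also have "\<dots> \<le> norm a * norm (lip V v v) * norm (cstar a)"
    by (meson norm_mult_ineq norm_ge_zero mult_right_mono order_trans)
  finally have "(norm (lact V a v))\<^sup>2 \<le> (norm a * norm v)\<^sup>2"
    by (simp add: norm_lip_self power2_eq_square mult_ac)
  then show ?thesis by (rule power2_le_imp_le) simp
qed

lemma norm_ract_le: "norm (ract V v b) \<le> norm v * norm b"
proof -
  have "(norm (ract V v b))\<^sup>2 = norm (cstar b * rip V v v * b)"
    by (simp add: norm_rip_self[symmetric] rip_ract_ract)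
  also have "\<dots> \<le> norm (cstar b) * norm (rip V v v) * norm b"
    by (meson norm_mult_ineq norm_ge_zero mult_right_mono order_trans)
  finally have "(norm (ract V v b))\<^sup>2 \<le> (norm v * norm b)\<^sup>2"
    by (simp add: norm_rip_self power2_eq_square mult_ac)
  then show ?thesis by (rule power2_le_imp_le) simp
qed

text \<open>
  The elements \<open>a = \<langle>v, v\<rangle> / \<parallel>v\<parallel>\<^sup>2\<close> stand in for an approximate unit:
  \<open>\<parallel>a v\<parallel>\<^sup>2 = \<parallel>a \<langle>v, v\<rangle> a\<^sup>*\<parallel>\<close> is a cube of a self-adjoint element, whose norm is known.
\<close>

lemma lact_norm_attained: "\<exists>a. norm a \<le> 1 \<and> norm (lact V a v) = norm v"
proof (cases "v = 0")
  case True
  then show ?thesis by (intro exI[of _ 0]) simp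
next
  case False
  define h where "h = lip V v v"
  have h: "cstar h = h" "norm h = (norm v)\<^sup>2"
    by (simp_all add: h_def lip_cstar norm_lip_self)
  \<comment> \<open>\<open>\<langle>h v, h v\<rangle> = h \<langle>v, v\<rangle> h\<close>, and the inner product is \<open>h\<close>.\<close>
  have "(norm (lact V h v))\<^sup>2 = norm (h * h * h)"
    using norm_lip_self[of "lact V h v"] by (simp add: lip_lact_lact h(1) flip: h_def)
  also have "\<dots> = ((norm v) ^ 3)\<^sup>2"
    by (simp add: norm_self_adjoint_cube[OF h(1)] h(2) flip: power_mult)
  finally have n: "norm (lact V h v) = norm v ^ 3"
    by (rule power2_eq_imp_eq) simp_all
  have "lact V ((1 / (norm v)\<^sup>2) *\<^sub>R h) v = (1 / (norm v)\<^sup>2) *\<^sub>R lact V h v"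
    by (simp add: scaleR_eq_scaleC lact_scaleC_left)
  with False n h(2) show ?thesis
    by (intro exI[of _ "(1 / (norm v)\<^sup>2) *\<^sub>R h"]) (simp add: power3_eq_cube power2_eq_square)
qed

lemma ract_norm_attained: "\<exists>b. norm b \<le> 1 \<and> norm (ract V v b) = norm v"
proof (cases "v = 0")
  case True
  then show ?thesis by (intro exI[of _ 0]) simp
next
  case False
  define h where "h = rip V v v"
  have h: "cstar h = h" "norm h = (norm v)\<^sup>2"
    by (simp_all add: h_def rip_cstar norm_rip_self)
  have "(norm (ract V v h))\<^sup>2 = norm (h * h * h)"
    using norm_rip_self[of "ract V v h"] by (simp add: rip_ract_ract h(1) flip: h_def)
  also have "\<dots> = ((norm v) ^ 3)\<^sup>2"
    by (simp add: norm_self_adjoint_cube[OF h(1)] h(2) flip: power_mult)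
  finally have n: "norm (ract V v h) = norm v ^ 3"
    by (rule power2_eq_imp_eq) simp_all
  have "ract V v ((1 / (norm v)\<^sup>2) *\<^sub>R h) = (1 / (norm v)\<^sup>2) *\<^sub>R ract V v h"
    by (simp add: scaleR_eq_scaleC ract_scaleC_right)
  with False n h(2) show ?thesis
    by (intro exI[of _ "(1 / (norm v)\<^sup>2) *\<^sub>R h"]) (simp add: power3_eq_cube power2_eq_square)
qed

lemma lact_cancel:
  assumes "\<And>c. lact V c v = lact V c w"
  shows "v = w"
  using lact_norm_attained[of "v - w"] assms by (auto simp: lact_diff)

lemma ract_cancel:
  assumes "\<And>c. ract V v c = ract V w c"
  shows "v = w"
  using ract_norm_attained[of "v - w"] assms by (auto simp: ract_diff)

lemma unitary_bimodule_map_isometry: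
  assumes "T \<in> unitary_bimodule_maps V"
  shows "norm (T v) = norm v"
proof -
  obtain S :: "'v \<Rightarrow>\<^sub>L 'v" where S: "\<And>v w. rip V (T v) w = rip V v (S w)" "S o\<^sub>L T = id_blinfun"
    using assms by (auto simp: unitary_bimodule_maps_def)
  have "S (T v) = v"
    using arg_cong[OF S(2), of "\<lambda>U. blinfun_apply U v"] by simp
  then have "rip V (T v) (T v) = rip V v v"
    by (simp add: S(1))
  then show ?thesis by (simp add: norm_rip)
qed

lemma unitary_bimodule_map_linear:
  assumes "T \<in> unitary_bimodule_maps V"
  shows "T (c *\<^sub>C v) = c *\<^sub>C T v" "T (lact V a v) = lact V a (T v)"
    "T (ract V v b) = ract V (T v) b"
  using assms by (auto simp: unitary_bimodule_maps_def adjointable_bimodule_maps_def)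

end

section \<open>Quasi-multipliers and the quasi-strict topology\<close>

lemma quasi_multipliersD:
  assumes "q \<in> quasi_multipliers A B W"
  shows "\<lbrakk>a \<in> carrier A; b \<in> carrier B\<rbrakk> \<Longrightarrow> q (a, b) \<in> carrier W"
    "q \<in> extensional (carrier A \<times> carrier B)"
    "\<lbrakk>a \<in> carrier A; a' \<in> carrier A; b \<in> carrier B\<rbrakk> \<Longrightarrow> q (add A a a', b) = add W (q (a, b)) (q (a', b))"
    "\<lbrakk>a \<in> carrier A; b \<in> carrier B; b' \<in> carrier B\<rbrakk> \<Longrightarrow> q (a, add B b b') = add W (q (a, b)) (q (a, b'))"
    "\<lbrakk>a \<in> carrier A; b \<in> carrier B\<rbrakk> \<Longrightarrow> q (scl A c a, b) = scl W c (q (a, b))"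
    "\<lbrakk>a \<in> carrier A; b \<in> carrier B\<rbrakk> \<Longrightarrow> q (a, scl B c b) = scl W c (q (a, b))"
    "\<exists>K. \<forall>a\<in>carrier A. \<forall>b\<in>carrier B. nrm W (q (a, b)) \<le> K * nrm A a * nrm B b"
    "\<lbrakk>a \<in> carrier A; a' \<in> carrier A; b \<in> carrier B; b' \<in> carrier B\<rbrakk> \<Longrightarrow>
      q (mul A a' a, mul B b b') = lact W a' (ract W (q (a, b)) b')"
  using assms unfolding quasi_multipliers_def mem_Collect_eq PiE_iff by blast+

lemma nrm_QM: "nrm (QM A B W) q =
    Sup {nrm W (q (a, b)) | a b. a \<in> carrier A \<and> b \<in> carrier B \<and> nrm A a \<le> 1 \<and> nrm B b \<le> 1}"
  by (simp add: QM_def)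

lemma carrier_QM [simp]: "carrier (QM A B W) = quasi_multipliers A B W"
  by (simp add: QM_def)

lemma nrm_QM_upper:
  assumes bound: "\<And>a b. \<lbrakk>a \<in> carrier A; b \<in> carrier B\<rbrakk> \<Longrightarrow> nrm W (q (a, b)) \<le> K * nrm A a * nrm B b"
    and nonneg: "\<And>a. a \<in> carrier A \<Longrightarrow> 0 \<le> nrm A a" "\<And>b. b \<in> carrier B \<Longrightarrow> 0 \<le> nrm B b"
    and a: "a \<in> carrier A" "nrm A a \<le> 1" and b: "b \<in> carrier B" "nrm B b \<le> 1"
  shows "nrm W (q (a, b)) \<le> nrm (QM A B W) q"
  unfolding nrm_QM
proof (rule cSup_upper)
  show "nrm W (q (a, b)) \<in> {nrm W (q (a, b)) | a b.
      a \<in> carrier A \<and> b \<in> carrier B \<and> nrm A a \<le> 1 \<and> nrm B b \<le> 1}"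
    using a b by blast
  have "nrm W (q (a, b)) \<le> \<bar>K\<bar>"
    if "a \<in> carrier A" "nrm A a \<le> 1" "b \<in> carrier B" "nrm B b \<le> 1" for a b
  proof -
    have "nrm W (q (a, b)) \<le> K * (nrm A a * nrm B b)"
      using bound that by (simp add: mult.assoc)
    also have "\<dots> \<le> \<bar>K\<bar> * (nrm A a * nrm B b)"
      using that nonneg by (intro mult_right_mono) simp_all
    also have "\<dots> \<le> \<bar>K\<bar> * 1"
      using that nonneg by (intro mult_left_mono mult_le_one) simp_all
    finally show ?thesis by simp
  qed
  then show "bdd_above {nrm W (q (a, b)) | a b.
      a \<in> carrier A \<and> b \<in> carrier B \<and> nrm A a \<le> 1 \<and> nrm B b \<le> 1}"
    by (auto intro!: bdd_aboveI[where M = "\<bar>K\<bar>"])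
qed

lemma nrm_QM_least:
  assumes "\<exists>a\<in>carrier A. nrm A a \<le> 1" "\<exists>b\<in>carrier B. nrm B b \<le> 1"
    and "\<And>a b. \<lbrakk>a \<in> carrier A; nrm A a \<le> 1; b \<in> carrier B; nrm B b \<le> 1\<rbrakk> \<Longrightarrow> nrm W (q (a, b)) \<le> M"
  shows "nrm (QM A B W) q \<le> M"
  unfolding nrm_QM using assms by (intro cSup_least) auto

context hilbert_bimodule
begin

abbreviation QMV :: "('a \<times> 'b \<Rightarrow> 'v) set" where
  "QMV \<equiv> quasi_multipliers type_algebra type_algebra V"

lemma QMV_iff: "q \<in> QMV \<longleftrightarrow>
    (\<forall>a a' b. q (a + a', b) = q (a, b) + q (a', b)) \<and>
    (\<forall>a b b'. q (a, b + b') = q (a, b) + q (a, b')) \<and>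
    (\<forall>c a b. q (c *\<^sub>C a, b) = c *\<^sub>C q (a, b)) \<and>
    (\<forall>c a b. q (a, c *\<^sub>C b) = c *\<^sub>C q (a, b)) \<and>
    (\<exists>K. \<forall>a b. norm (q (a, b)) \<le> K * norm a * norm b) \<and>
    (\<forall>a c b d. q (c * a, b * d) = lact V c (ract V (q (a, b)) d))"
  by (simp add: quasi_multipliers_def carrier_V add_V scl_V nrm_V)

lemma QMV_D:
  assumes "q \<in> QMV"
  shows "q (a + a', b) = q (a, b) + q (a', b)" "q (a, b + b') = q (a, b) + q (a, b')"
    "q (c *\<^sub>C a, b) = c *\<^sub>C q (a, b)" "q (a, c *\<^sub>C b) = c *\<^sub>C q (a, b)"
    "q (a' * a, b * b') = lact V a' (ract V (q (a, b)) b')"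
  using assms by (simp_all add: QMV_iff)

lemma QMV_diff:
  assumes "q \<in> QMV"
  shows "q (a - a', b) = q (a, b) - q (a', b)" "q (a, b - b') = q (a, b) - q (a, b')"
  using QMV_D(1)[OF assms, of "a - a'" a' b] QMV_D(2)[OF assms, of a "b - b'" b']
  by (simp_all add: algebra_simps)

lemma norm_le_nrm_QMV:
  assumes "q \<in> QMV" "norm a \<le> 1" "norm b \<le> 1"
  shows "norm (q (a, b)) \<le> nrm (QM type_algebra type_algebra V) q"
proof -
  obtain K where K: "\<And>a b. norm (q (a, b)) \<le> K * norm a * norm b"
    using assms(1) by (auto simp: QMV_iff)
  show ?thesis
    using nrm_QM_upper[of type_algebra type_algebra V q K a b] K assms by (simp add: nrm_V)
qed

lemma nrm_QMV_least:
  assumes "\<And>a b. norm a \<le> 1 \<Longrightarrow> norm b \<le> 1 \<Longrightarrow> norm (q (a, b)) \<le> M"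
  shows "nrm (QM type_algebra type_algebra V) q \<le> M"
  by (rule nrm_QM_least) (use assms in \<open>auto simp: nrm_V intro: exI[of _ 0]\<close>)

text \<open>By homogeneity, the bound on the unit balls extends to all arguments.\<close>

lemma norm_QMV_le:
  assumes q: "q \<in> QMV" and M: "nrm (QM type_algebra type_algebra V) q \<le> M"
  shows "norm (q (a, b)) \<le> M * norm a * norm b"
proof (cases "a = 0 \<or> b = 0")
  case True
  then show ?thesis
    using QMV_D(1)[OF q, of 0 0 b] QMV_D(2)[OF q, of a 0 0] by auto
next
  case False
  have "q ((1 / norm a) *\<^sub>R a, (1 / norm b) *\<^sub>R b) = (1 / (norm a * norm b)) *\<^sub>R q (a, b)"
    by (simp add: QMV_D[OF q] scaleR_eq_scaleC scaleC_scaleC mult.commute)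
  moreover have "norm (q ((1 / norm a) *\<^sub>R a, (1 / norm b) *\<^sub>R b)) \<le> M"
    using norm_le_nrm_QMV[OF q, of "(1 / norm a) *\<^sub>R a" "(1 / norm b) *\<^sub>R b"] M False by simp
  ultimately show ?thesis
    using False by (simp add: divide_simps mult_ac)
qed

lemma QM_V_simps:
  "add (QM type_algebra type_algebra V) q r = (\<lambda>z. q z + r z)"
  "scl (QM type_algebra type_algebra V) c q = (\<lambda>z. c *\<^sub>C q z)"
  "lact (QM type_algebra type_algebra V) a q = (\<lambda>(a', b'). q (a' * a, b'))"
  "ract (QM type_algebra type_algebra V) q b = (\<lambda>(a', b'). q (a', b * b'))"
  by (auto simp: QM_def add_V scl_V)

lemma QM_V_closed:
  assumes "q \<in> QMV" "r \<in> QMV"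
  shows "add (QM type_algebra type_algebra V) q r \<in> QMV"
    "scl (QM type_algebra type_algebra V) c q \<in> QMV"
    "lact (QM type_algebra type_algebra V) a q \<in> QMV"
    "ract (QM type_algebra type_algebra V) q b \<in> QMV"
proof -
  obtain K where K: "\<And>a b. norm (q (a, b)) \<le> K * norm a * norm b"
    using assms(1) by (auto simp: QMV_iff)
  obtain L where L: "\<And>a b. norm (r (a, b)) \<le> L * norm a * norm b"
    using assms(2) by (auto simp: QMV_iff)
  have K0: "norm (q (a, b)) \<le> \<bar>K\<bar> * norm a * norm b" for a b
    using K[of a b] by (rule order_trans) (simp add: mult_right_mono)
  have 1: "norm (q (a, b) + r (a, b)) \<le> (K + L) * norm a * norm b" for a b
    using norm_triangle_ineq[of "q (a, b)" "r (a, b)"] K[of a b] L[of a b]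
    by (simp add: algebra_simps)
  have 2: "norm (c *\<^sub>C q (a, b)) \<le> (cmod c * K) * norm a * norm b" for a b
    using K[of a b] by (simp add: norm_scaleC mult_left_mono mult.assoc)
  have 3: "norm (q (a' * a, b)) \<le> (\<bar>K\<bar> * norm a) * norm a' * norm b" for a' b
    by (rule order_trans[OF K0], rule order_trans,
      rule mult_right_mono[OF mult_left_mono[OF norm_mult_ineq]]) (simp_all add: mult_ac)
  have 4: "norm (q (a, b * b')) \<le> (\<bar>K\<bar> * norm b) * norm a * norm b'" for a b'
    by (rule order_trans[OF K0], rule order_trans,
      rule mult_left_mono[OF norm_mult_ineq]) (simp_all add: mult_ac)
  show "add (QM type_algebra type_algebra V) q r \<in> QMV"
    unfolding QMV_iff QM_V_simps using QMV_D[OF assms(1)] QMV_D[OF assms(2)] 1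
    by (auto simp: scaleC_add_right lact_add_right ract_add_left)
  show "scl (QM type_algebra type_algebra V) c q \<in> QMV"
    unfolding QMV_iff QM_V_simps using QMV_D[OF assms(1)] 2
    by (auto simp: scaleC_add_right scaleC_commute lact_scaleC_right ract_scaleC_left)
  have 3: "\<exists>L. \<forall>a' b. norm (q (a' * a, b)) \<le> L * norm a' * norm b"
    using 3 by blast
  show "lact (QM type_algebra type_algebra V) a q \<in> QMV"
    unfolding QMV_iff QM_V_simps using QMV_D[OF assms(1)] 3
    by (auto simp: distrib_right mult_scaleC_left mult.assoc)
  have 4: "\<exists>L. \<forall>a b'. norm (q (a, b * b')) \<le> L * norm a * norm b'"
    using 4 by blast
  show "ract (QM type_algebra type_algebra V) q b \<in> QMV"
    unfolding QMV_iff QM_V_simps using QMV_D(1-4)[OF assms(1)] 4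
      QMV_D(5)[OF assms(1), of _ _ "b * _"]
    by (auto simp: distrib_left mult_scaleC_right mult.assoc)
qed

text \<open>
  In the seminorm \<open>\<parallel>a \<lhd> q \<rhd> b\<parallel>\<close> one evaluates \<open>q\<close> at \<open>(a' a, b b')\<close>, which gives
  \<open>a' q(a, b) b'\<close>; this has at most the norm of \<open>q(a, b)\<close>, and the norm is attained.
\<close>

lemma quasi_strict_seminorm:
  assumes q: "q \<in> QMV"
  shows "nrm (QM type_algebra type_algebra V)
      (ract (QM type_algebra type_algebra V) (lact (QM type_algebra type_algebra V) a q) b)
    = norm (q (a, b))" (is "nrm ?M ?r = _")
proof (rule antisym)
  have r: "?r (a', b') = lact V a' (ract V (q (a, b)) b')" for a' b'
    by (simp add: QM_V_simps QMV_D(5)[OF q])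
  have "norm (lact V a' (ract V (q (a, b)) b')) \<le> norm (q (a, b))"
    if "norm a' \<le> 1" "norm b' \<le> 1" for a' b'
  proof -
    have "norm (lact V a' (ract V (q (a, b)) b')) \<le> norm a' * norm (ract V (q (a, b)) b')"
      by (rule norm_lact_le)
    also have "\<dots> \<le> norm (ract V (q (a, b)) b')"
      using that by (simp add: mult_left_le_one_le)
    also have "\<dots> \<le> norm (q (a, b)) * norm b'"
      by (rule norm_ract_le)
    also have "\<dots> \<le> norm (q (a, b))"
      using that by (simp add: mult_right_le_one_le)
    finally show ?thesis .
  qed
  then show "nrm ?M ?r \<le> norm (q (a, b))"
    by (intro nrm_QMV_least) (simp add: r)
  obtain b' where b': "norm b' \<le> 1" "norm (ract V (q (a, b)) b') = norm (q (a, b))"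
    using ract_norm_attained by blast
  obtain a' where a': "norm a' \<le> 1"
    "norm (lact V a' (ract V (q (a, b)) b')) = norm (ract V (q (a, b)) b')"
    using lact_norm_attained by blast
  have "norm (?r (a', b')) \<le> nrm ?M ?r"
    using q a'(1) b'(1) by (intro norm_le_nrm_QMV QM_V_closed)
  then show "norm (q (a, b)) \<le> nrm ?M ?r"
    by (simp only: r a'(2) b'(2))
qed

lemma quasi_strict_topology_eq:
  "quasi_strict_topology type_algebra type_algebra V =
   topology_generated_by
     {{r \<in> QMV. norm (r (a, b) - q (a, b)) < \<epsilon>} | a b q \<epsilon>. q \<in> QMV \<and> 0 < \<epsilon>}"
proof -
  let ?M = "QM type_algebra type_algebra V"
  have "nrm ?M (ract ?M (lact ?M a (add ?M r (scl ?M (-1) q))) b) = norm (r (a, b) - q (a, b))"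
    if "q \<in> QMV" "r \<in> QMV" for a b q r
  proof -
    have "add ?M r (scl ?M (-1) q) \<in> QMV"
      using that by (intro QM_V_closed)
    from quasi_strict_seminorm[OF this, of a b] show ?thesis
      by (simp only: QM_V_simps(1,2) scaleC_minus1) simp
  qed
  then have eq: "{r \<in> QMV. nrm ?M (ract ?M (lact ?M a (add ?M r (scl ?M (-1) q))) b) < \<epsilon>}
      = {r \<in> QMV. norm (r (a, b) - q (a, b)) < \<epsilon>}" if "q \<in> QMV" for a b q \<epsilon>
    using that by auto
  have cong: "{f a b q \<epsilon> | a b q \<epsilon>. a \<in> UNIV \<and> b \<in> UNIV \<and> P q \<epsilon>} = {g a b q \<epsilon> | a b q \<epsilon>. P q \<epsilon>}"
    if "\<And>a b q \<epsilon>. P q \<epsilon> \<Longrightarrow> f a b q \<epsilon> = g a b q \<epsilon>" for f g and P :: "_ \<Rightarrow> real \<Rightarrow> bool"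
    using that by (metis UNIV_I)
  show ?thesis
    unfolding quasi_strict_topology_def Let_def carrier_QM type_algebra_simps
    by (intro arg_cong[where f = topology_generated_by] cong eq) simp
qed

lemma topspace_quasi_strict [simp]:
  "topspace (quasi_strict_topology type_algebra type_algebra V) = QMV"
proof -
  have "q \<in> {r \<in> QMV. norm (r (0, 0) - q (0, 0)) < 1}" if "q \<in> QMV" for q
    using that by simp
  then show ?thesis
    unfolding quasi_strict_topology_eq topology_generated_by_topspace
    using zero_less_one[where 'a = real] by blast
qed

text \<open>
  Hence the quasi-strict topology is the initial topology for the evaluations
  \<open>q \<mapsto> q(a, b)\<close>, where \<open>V\<close> carries its norm topology.
\<close>

lemma continuous_map_quasi_strict_iff:
  "continuous_map Z (quasi_strict_topology type_algebra type_algebra V) g \<longleftrightarrow>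
   g ` topspace Z \<subseteq> QMV \<and> (\<forall>a b. continuous_map Z euclidean (\<lambda>z. g z (a, b)))"
  (is "?L \<longleftrightarrow> ?R")
proof
  assume L: ?L
  have g: "g z \<in> QMV" if "z \<in> topspace Z" for z
    using continuous_map_image_subset_topspace[OF L] that by auto
  have "\<exists>U. openin Z U \<and> z \<in> U \<and> (\<forall>y\<in>U. dist (g y (a, b)) (g z (a, b)) < \<epsilon>)"
    if "z \<in> topspace Z" "0 < \<epsilon>" for z a b \<epsilon>
  proof (intro exI conjI)
    let ?W = "{r \<in> QMV. norm (r (a, b) - g z (a, b)) < \<epsilon>}"
    have "openin (quasi_strict_topology type_algebra type_algebra V) ?W"
      unfolding quasi_strict_topology_eq using that g by (intro topology_generated_by_Basis) blast
    with L show "openin Z {y \<in> topspace Z. g y \<in> ?W}"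
      by (rule openin_continuous_map_preimage)
  qed (use that g in \<open>auto simp: dist_norm\<close>)
  then have "((\<lambda>y. g y (a, b)) \<longlongrightarrow> g z (a, b)) (atin Z z)" if "z \<in> topspace Z" for z a b
    unfolding tendsto_iff eventually_atin using that by (metis DiffE)
  with g show ?R
    by (auto simp: continuous_map_atin)
next
  assume R: ?R
  show ?L
    unfolding quasi_strict_topology_eq
  proof (rule continuous_on_generated_topo)
    fix U assume "U \<in> {{r \<in> QMV. norm (r (a, b) - q (a, b)) < \<epsilon>} | a b q \<epsilon>. q \<in> QMV \<and> 0 < \<epsilon>}"
    then obtain a b q \<epsilon> where U: "U = {r \<in> QMV. norm (r (a, b) - q (a, b)) < \<epsilon>}"
      by blast
    have "openin Z {z \<in> topspace Z. g z (a, b) \<in> ball (q (a, b)) \<epsilon>}"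
      using R by (intro openin_continuous_map_preimage[where Y = euclidean]) auto
    moreover have "{z \<in> topspace Z. g z (a, b) \<in> ball (q (a, b)) \<epsilon>} = g -` U \<inter> topspace Z"
      using R by (auto simp: U dist_norm norm_minus_commute)
    ultimately show "openin Z (g -` U \<inter> topspace Z)" by simp
  next
    show "g ` topspace Z \<subseteq>
        \<Union>{{r \<in> QMV. norm (r (a, b) - q (a, b)) < \<epsilon>} | a b q \<epsilon>. q \<in> QMV \<and> 0 < \<epsilon>}"
      using R topspace_quasi_strict
      unfolding quasi_strict_topology_eq topology_generated_by_topspace by blast
  qed
qed

lemma continuous_map_eval:
  "continuous_map (quasi_strict_topology type_algebra type_algebra V) euclidean (\<lambda>q. q (a, b))"
  using continuous_map_quasi_strict_iff[of "quasi_strict_topology type_algebra type_algebra V" id]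
  by simp

lemma isometric_bimodule_map_QMV:
  assumes q: "q \<in> QMV"
    and t: "\<And>v. norm (t v) = norm v" "\<And>v w. t (v + w) = t v + t w" "\<And>c v. t (c *\<^sub>C v) = c *\<^sub>C t v"
      "\<And>a v. t (lact V a v) = lact V a (t v)" "\<And>v b. t (ract V v b) = ract V (t v) b"
  shows "t \<circ> q \<in> QMV"
  using q unfolding QMV_iff by (simp add: t)

end

section \<open>Continuous functions vanishing at infinity\<close>

lemma sup_over_least:
  assumes "0 \<le> M" "\<And>x. x \<in> topspace X \<Longrightarrow> h x \<le> M"
  shows "sup_over X h \<le> M"
  unfolding sup_over_def using assms by (intro cSup_least) auto

lemma sup_over_upper:
  assumes "\<And>x. x \<in> topspace X \<Longrightarrow> h x \<le> K"
  shows "x \<in> topspace X \<Longrightarrow> h x \<le> sup_over X h" "0 \<le> sup_over X h"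
proof -
  have "bdd_above (insert 0 (h ` topspace X))"
    using assms by (intro bdd_aboveI[where M = "max 0 K"]) (auto simp: le_max_iff_disj)
  then show "x \<in> topspace X \<Longrightarrow> h x \<le> sup_over X h" "0 \<le> sup_over X h"
    unfolding sup_over_def by (auto intro!: cSup_upper)
qed

lemma sqrt_sup_over_square:
  assumes nonneg: "\<And>x. x \<in> topspace X \<Longrightarrow> 0 \<le> h x"
    and bound: "\<And>x. x \<in> topspace X \<Longrightarrow> h x \<le> K"
  shows "sqrt (sup_over X (\<lambda>x. (h x)\<^sup>2)) = sup_over X h"
proof (rule antisym)
  have bound2: "(h x)\<^sup>2 \<le> K\<^sup>2" if "x \<in> topspace X" for x
    using nonneg bound that by (intro power_mono) auto
  have "sup_over X (\<lambda>x. (h x)\<^sup>2) \<le> (sup_over X h)\<^sup>2"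
    using sup_over_upper[where h = h and X = X, OF bound] nonneg
    by (intro sup_over_least power_mono) auto
  then show "sqrt (sup_over X (\<lambda>x. (h x)\<^sup>2)) \<le> sup_over X h"
    using sup_over_upper(2)[where h = h and X = X, OF bound] by (intro real_le_lsqrt) auto
  show "sup_over X h \<le> sqrt (sup_over X (\<lambda>x. (h x)\<^sup>2))"
    using sup_over_upper[where h = "\<lambda>x. (h x)\<^sup>2" and X = X, OF bound2]
    by (intro sup_over_least real_le_rsqrt) auto
qed

lemma vanishes_at_infinity_cong:
  assumes "\<And>x. x \<in> topspace X \<Longrightarrow> g x = h x"
  shows "vanishes_at_infinity X g \<longleftrightarrow> vanishes_at_infinity X h"
  using assms by (simp add: vanishes_at_infinity_def)

lemma vanishes_at_infinity_mono:
  assumes h: "vanishes_at_infinity X h" and g: "\<And>x. x \<in> topspace X \<Longrightarrow> \<bar>g x\<bar> \<le> C * \<bar>h x\<bar>"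
  shows "vanishes_at_infinity X g"
  unfolding vanishes_at_infinity_def
proof (intro allI impI)
  fix \<epsilon> :: real assume "0 < \<epsilon>"
  then have "0 < \<epsilon> / (\<bar>C\<bar> + 1)" by simp
  then obtain K where K: "compactin X K" "\<And>x. x \<in> topspace X - K \<Longrightarrow> \<bar>h x\<bar> < \<epsilon> / (\<bar>C\<bar> + 1)"
    using h unfolding vanishes_at_infinity_def by blast
  have "\<bar>g x\<bar> < \<epsilon>" if "x \<in> topspace X - K" for x
  proof -
    have "\<bar>g x\<bar> \<le> C * \<bar>h x\<bar>" using g that by simp
    also have "\<dots> \<le> (\<bar>C\<bar> + 1) * \<bar>h x\<bar>" by (intro mult_right_mono) auto
    also have "\<dots> < \<epsilon>" using K(2)[OF that] by (simp add: field_simps)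
    finally show ?thesis .
  qed
  with K(1) show "\<exists>K. compactin X K \<and> (\<forall>x\<in>topspace X - K. \<bar>g x\<bar> < \<epsilon>)" by blast
qed

lemma vanishes_at_infinity_add:
  assumes g: "vanishes_at_infinity X g" and h: "vanishes_at_infinity X h"
  shows "vanishes_at_infinity X (\<lambda>x. g x + h x)"
  unfolding vanishes_at_infinity_def
proof (intro allI impI)
  fix \<epsilon> :: real assume "0 < \<epsilon>"
  then have "0 < \<epsilon> / 2" by simp
  then obtain K L where K: "compactin X K" "\<And>x. x \<in> topspace X - K \<Longrightarrow> \<bar>g x\<bar> < \<epsilon> / 2"
    and L: "compactin X L" "\<And>x. x \<in> topspace X - L \<Longrightarrow> \<bar>h x\<bar> < \<epsilon> / 2"
    using g h unfolding vanishes_at_infinity_def by meson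
  have "\<bar>g x + h x\<bar> < \<epsilon>" if "x \<in> topspace X - (K \<union> L)" for x
    using K(2)[of x] L(2)[of x] that by auto
  with compactin_Un[OF K(1) L(1)]
  show "\<exists>K. compactin X K \<and> (\<forall>x\<in>topspace X - K. \<bar>g x + h x\<bar> < \<epsilon>)" by blast
qed

lemma vanishing_bounded:
  assumes h: "vanishes_at_infinity X h" "continuous_map X euclideanreal h"
  obtains K where "\<And>x. x \<in> topspace X \<Longrightarrow> \<bar>h x\<bar> \<le> K"
proof -
  obtain K where K: "compactin X K" "\<And>x. x \<in> topspace X - K \<Longrightarrow> \<bar>h x\<bar> < 1"
    using h(1) unfolding vanishes_at_infinity_def by (meson zero_less_one)
  have "compact (h ` K)"
    using image_compactin[OF K(1) h(2)] by simp
  then have "\<exists>M. \<forall>y\<in>h ` K. norm y \<le> M"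
    by (metis compact_imp_bounded bounded_iff)
  then obtain M where M: "\<And>x. x \<in> K \<Longrightarrow> \<bar>h x\<bar> \<le> M"
    by auto
  show thesis
    using K(2) M by (intro that[of "max 1 M"]) (metis DiffI le_max_iff_disj less_imp_le)
qed

lemma C0_simps [simp]:
  "add (C0 X) f g = (\<lambda>x\<in>topspace X. f x + g x)"
  "scl (C0 X) c f = (\<lambda>x\<in>topspace X. c *\<^sub>C f x)"
  "mul (C0 X) f g = (\<lambda>x\<in>topspace X. f x * g x)"
  "nrm (C0 X) f = sup_over X (\<lambda>x. norm (f x))"
  by (simp_all add: C0_def)

lemma carrier_C0_iff: "f \<in> carrier (C0 X) \<longleftrightarrow> f \<in> extensional (topspace X) \<and>
    (\<forall>x\<in>topspace X. (f \<longlongrightarrow> f x) (atin X x)) \<and> vanishes_at_infinity X (\<lambda>x. norm (f x))"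
  by (simp add: C0_def continuous_map_atin)

lemma restrict_tendsto_atin:
  assumes "x \<in> topspace X" "(f \<longlongrightarrow> f x) (atin X x)"
  shows "((\<lambda>x\<in>topspace X. f x) \<longlongrightarrow> (\<lambda>x\<in>topspace X. f x) x) (atin X x)"
proof -
  have "eventually (\<lambda>y. f y = (\<lambda>x\<in>topspace X. f x) y) (atin X x)"
    unfolding eventually_atin using assms(1) by (intro disjI2 exI[of _ "topspace X"]) auto
  then show ?thesis
    using assms by (auto intro: Lim_transform_eventually)
qed

lemma restrict_in_C0I:
  assumes "\<And>x. x \<in> topspace X \<Longrightarrow> (f \<longlongrightarrow> f x) (atin X x)"
    and "vanishes_at_infinity X (\<lambda>x. norm (f x))"
  shows "(\<lambda>x\<in>topspace X. f x) \<in> carrier (C0 X)"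
  unfolding carrier_C0_iff using assms(1) restrict_tendsto_atin[of _ X f]
  by (auto intro: vanishes_at_infinity_mono[OF assms(2), where C = 1])

lemma C0_tendsto:
  assumes "f \<in> carrier (C0 X)" "x \<in> topspace X"
  shows "(f \<longlongrightarrow> f x) (atin X x)"
  using assms by (simp add: carrier_C0_iff)

lemma C0_bounded:
  assumes "f \<in> carrier (C0 X)"
  obtains K where "\<And>x. x \<in> topspace X \<Longrightarrow> norm (f x) \<le> K"
proof -
  have "continuous_map X euclideanreal (\<lambda>x. norm (f x))"
    using assms by (auto simp: carrier_C0_iff continuous_map_atin intro: tendsto_norm)
  with assms obtain K where "\<And>x. x \<in> topspace X \<Longrightarrow> \<bar>norm (f x)\<bar> \<le> K"
    unfolding carrier_C0_iff by (metis vanishing_bounded)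
  with that[of K] show thesis by simp
qed

lemma norm_le_nrm_C0:
  assumes "f \<in> carrier (C0 X)" "x \<in> topspace X"
  shows "norm (f x) \<le> nrm (C0 X) f"
  using assms by (metis C0_bounded C0_simps(4) sup_over_upper(1))

lemma nrm_C0_nonneg: "f \<in> carrier (C0 X) \<Longrightarrow> 0 \<le> nrm (C0 X) f"
  by (metis C0_bounded C0_simps(4) sup_over_upper(2))

lemma nrm_C0_least: "0 \<le> M \<Longrightarrow> (\<And>x. x \<in> topspace X \<Longrightarrow> norm (f x) \<le> M) \<Longrightarrow> nrm (C0 X) f \<le> M"
  by (simp add: sup_over_least)

lemma C0_add: "f \<in> carrier (C0 X) \<Longrightarrow> g \<in> carrier (C0 X) \<Longrightarrow> add (C0 X) f g \<in> carrier (C0 X)"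
  unfolding C0_simps
proof (rule restrict_in_C0I)
  assume f: "f \<in> carrier (C0 X)" and g: "g \<in> carrier (C0 X)"
  then show "((\<lambda>x. f x + g x) \<longlongrightarrow> f x + g x) (atin X x)" if "x \<in> topspace X" for x
    using that by (intro tendsto_add C0_tendsto)
  have "vanishes_at_infinity X (\<lambda>x. norm (f x) + norm (g x))"
    using f g by (intro vanishes_at_infinity_add) (simp_all add: carrier_C0_iff)
  then show "vanishes_at_infinity X (\<lambda>x. norm (f x + g x))"
    by (rule vanishes_at_infinity_mono[where C = 1]) (simp add: norm_triangle_ineq)
qed

lemma C0_scl: "f \<in> carrier (C0 X) \<Longrightarrow> scl (C0 X) c f \<in> carrier (C0 X)"
  unfolding C0_simps
proof (rule restrict_in_C0I)
  assume f: "f \<in> carrier (C0 X)"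
  then show "((\<lambda>x. c *\<^sub>C f x) \<longlongrightarrow> c *\<^sub>C f x) (atin X x)" if "x \<in> topspace X" for x
    using that by (intro scaleC_tendsto C0_tendsto)
  from f have "vanishes_at_infinity X (\<lambda>x. norm (f x))"
    by (simp add: carrier_C0_iff)
  then show "vanishes_at_infinity X (\<lambda>x. norm (c *\<^sub>C f x))"
    by (rule vanishes_at_infinity_mono[where C = "cmod c"]) (simp add: norm_scaleC)
qed

lemma C0_mul: "f \<in> carrier (C0 X) \<Longrightarrow> g \<in> carrier (C0 X) \<Longrightarrow> mul (C0 X) f g \<in> carrier (C0 X)"
  unfolding C0_simps
proof (rule restrict_in_C0I)
  assume f: "f \<in> carrier (C0 X)" and g: "g \<in> carrier (C0 X)"
  then show "((\<lambda>x. f x * g x) \<longlongrightarrow> f x * g x) (atin X x)" if "x \<in> topspace X" for x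
    using that by (intro tendsto_mult C0_tendsto)
  obtain K where K: "\<And>x. x \<in> topspace X \<Longrightarrow> norm (f x) \<le> K"
    using C0_bounded[OF f] by metis
  from g have "vanishes_at_infinity X (\<lambda>x. norm (g x))"
    by (simp add: carrier_C0_iff)
  then show "vanishes_at_infinity X (\<lambda>x. norm (f x * g x))"
    by (rule vanishes_at_infinity_mono[where C = K])
      (use K in \<open>auto intro!: order_trans[OF norm_mult_ineq] mult_right_mono\<close>)
qed

lemma C0_scaleR:
  assumes f: "f \<in> carrier (C0 X)" and \<phi>: "continuous_map X euclideanreal \<phi>"
    and \<phi>1: "\<And>x. x \<in> topspace X \<Longrightarrow> \<bar>\<phi> x\<bar> \<le> 1"
  shows "(\<lambda>x\<in>topspace X. \<phi> x *\<^sub>R f x) \<in> carrier (C0 X)"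
proof (rule restrict_in_C0I)
  show "((\<lambda>x. \<phi> x *\<^sub>R f x) \<longlongrightarrow> \<phi> x *\<^sub>R f x) (atin X x)" if "x \<in> topspace X" for x
    using that f \<phi> by (intro tendsto_scaleR C0_tendsto) (auto simp: continuous_map_atin)
  from f have "vanishes_at_infinity X (\<lambda>x. norm (f x))"
    by (simp add: carrier_C0_iff)
  then show "vanishes_at_infinity X (\<lambda>x. norm (\<phi> x *\<^sub>R f x))"
    by (rule vanishes_at_infinity_mono[where C = 1]) (use \<phi>1 in \<open>auto intro: mult_left_le_one_le\<close>)
qed

section \<open>Sections of the bundle in fibre coordinates\<close>

lemma atin_open_subtopology:
  assumes "openin X U" "x \<in> U"
  shows "atin (subtopology X U) x = atin X x"
proof (rule filter_eq_iff[THEN iffD2], intro allI)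
  fix P
  have x: "x \<in> topspace X" using assms openin_subset by blast
  show "eventually P (atin (subtopology X U) x) = eventually P (atin X x)"
  proof
    assume "eventually P (atin (subtopology X U) x)"
    then show "eventually P (atin X x)"
      using assms x unfolding eventually_atin by (auto simp: openin_open_subtopology)
  next
    assume "eventually P (atin X x)"
    then obtain W where "openin X W" "x \<in> W" "\<forall>y\<in>W - {x}. P y"
      using x unfolding eventually_atin by blast
    then show "eventually P (atin (subtopology X U) x)"
      using assms unfolding eventually_atin
      by (intro disjI2 exI[of _ "W \<inter> U"]) (auto simp: openin_open_subtopology openin_Int)
  qed
qed

lemma continuous_map_open_subtopology_iff:
  assumes "openin X U"
  shows "continuous_map (subtopology X U) euclidean f \<longleftrightarrow> (\<forall>x\<in>U. (f \<longlongrightarrow> f x) (atin X x))"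
  using assms openin_subset[OF assms]
  by (auto simp: continuous_map_atin atin_open_subtopology Int_absorb1)

context hilbert_bimodule_bundle
begin

abbreviation "X \<equiv> base_space E"
abbreviation "I \<equiv> chart_index E"
abbreviation "U \<equiv> nbhd E"

lemma nbhd_subset: "i \<in> I \<Longrightarrow> U i \<subseteq> topspace X"
  using open_nbhd openin_subset by blast

lemma nbhd_topspace: "i \<in> I \<Longrightarrow> x \<in> U i \<Longrightarrow> x \<in> topspace X"
  using nbhd_subset by blast

lemma chart_at:
  assumes "x \<in> topspace X"
  shows "chart_at E x \<in> I" "x \<in> U (chart_at E x)"
proof -
  have "\<exists>i. i \<in> I \<and> x \<in> U i"
    using assms cover by blast
  from someI_ex[OF this] show "chart_at E x \<in> I" "x \<in> U (chart_at E x)"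
    by (simp_all add: chart_at_def)
qed

abbreviation total_over :: "'i \<Rightarrow> 'e set" where
  "total_over i \<equiv> {e \<in> topspace (total_space E). projection E e \<in> U i}"

lemma triv_homeomorphic_maps:
  assumes i: "i \<in> I"
  shows "homeomorphic_maps (subtopology (total_space E) (total_over i))
      (prod_topology (subtopology X (U i)) euclidean) (triv E i) (triv_inv E i)"
proof -
  obtain g where g: "homeomorphic_maps (subtopology (total_space E) (total_over i))
      (prod_topology (subtopology X (U i)) euclidean) (triv E i) g"
    using homeo_triv[OF i] by (auto simp: homeomorphic_map_maps)
  have inj: "inj_on (triv E i) (total_over i)"
    using homeomorphic_imp_injective_map[OF homeo_triv[OF i]] by (simp add: Int_def conj_commute)
  have "g p = triv_inv E i p" if p: "p \<in> topspace (prod_topology (subtopology X (U i)) euclidean)" for p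
  proof -
    have "g p \<in> topspace (subtopology (total_space E) (total_over i))"
      using g p unfolding homeomorphic_maps_def by (blast dest: continuous_map_funspace)
    then have "g p \<in> total_over i" by simp
    moreover have "triv E i (g p) = p"
      using g p unfolding homeomorphic_maps_def by blast
    ultimately show ?thesis
      using inv_into_f_eq[OF inj] by (simp only: triv_inv_def)
  qed
  then show ?thesis
    by (rule homeomorphic_maps_eq[OF g refl])
qed

lemma triv_inv:
  assumes "i \<in> I" "x \<in> U i"
  shows "triv_inv E i (x, v) \<in> topspace (total_space E)" "projection E (triv_inv E i (x, v)) = x"
    "triv E i (triv_inv E i (x, v)) = (x, v)"
proof -
  have p: "(x, v) \<in> topspace (prod_topology (subtopology X (U i)) euclidean)"
    using assms nbhd_subset by auto
  then have "triv_inv E i (x, v) \<in> topspace (subtopology (total_space E) (total_over i))"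
    using triv_homeomorphic_maps[OF assms(1)]
    unfolding homeomorphic_maps_def by (blast dest: continuous_map_funspace)
  then have e: "triv_inv E i (x, v) \<in> total_over i"
    by simp
  show t: "triv E i (triv_inv E i (x, v)) = (x, v)"
    using triv_homeomorphic_maps[OF assms(1)] p unfolding homeomorphic_maps_def by blast
  from e show "triv_inv E i (x, v) \<in> topspace (total_space E)" by simp
  show "projection E (triv_inv E i (x, v)) = x"
    using fst_triv[OF assms(1)] e t by (metis (mono_tags, lifting) fst_conv mem_Collect_eq)
qed

lemma triv_inv_triv:
  assumes "i \<in> I" "e \<in> topspace (total_space E)" "projection E e \<in> U i"
  shows "triv_inv E i (projection E e, snd (triv E i e)) = e"
proof -
  have "triv_inv E i (triv E i e) = e"
    using triv_homeomorphic_maps[OF assms(1)] assms by (simp add: homeomorphic_maps_def)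
  then show ?thesis
    by (metis assms fst_triv prod.collapse)
qed

lemma triv_inv_transition:
  assumes "i \<in> I" "j \<in> I" "x \<in> U i" "x \<in> U j"
  shows "triv_inv E j (x, transition E i j x v) = triv_inv E i (x, v)"
  using triv_inv_triv[OF assms(2), of "triv_inv E i (x, v)"] triv_inv[OF assms(1,3), of v] assms
  by (simp add: transition_def)

lemma transition_self: "i \<in> I \<Longrightarrow> x \<in> U i \<Longrightarrow> transition E i i x v = v"
  by (simp add: transition_def triv_inv)

lemma transition_transition:
  assumes "i \<in> I" "j \<in> I" "k \<in> I" "x \<in> U i" "x \<in> U j" "x \<in> U k"
  shows "transition E j k x (transition E i j x v) = transition E i k x v"
  unfolding transition_def[of E j k] triv_inv_transition[OF assms(1,2,4,5)]
  by (simp add: transition_def)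

lemma transition_eq_unitary:
  assumes "i \<in> I" "j \<in> I"
  shows "\<exists>T. (\<forall>x\<in>U i \<inter> U j. transition E i j x = blinfun_apply (T x) \<and> T x \<in> unitary_bimodule_maps V) \<and>
    continuous_map (subtopology X (U i \<inter> U j)) euclidean T"
proof -
  obtain T where T: "continuous_map (subtopology X (U i \<inter> U j)) (top_of_set (unitary_bimodule_maps V)) T"
    "\<forall>x \<in> U i \<inter> U j. transition E i j x = blinfun_apply (T x)"
    using transition_unitary[OF assms] by blast
  have "topspace (subtopology X (U i \<inter> U j)) = U i \<inter> U j"
    using nbhd_subset[OF assms(1)] by auto
  with T show ?thesis
    by (intro exI[of _ T]) (auto simp: continuous_map_in_subtopology)
qed

lemma transition_bimodule_map:
  assumes "i \<in> I" "j \<in> I" "x \<in> U i" "x \<in> U j"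
  shows "norm (transition E i j x v) = norm v"
    "transition E i j x (v + w) = transition E i j x v + transition E i j x w"
    "transition E i j x (v - w) = transition E i j x v - transition E i j x w"
    "transition E i j x (c *\<^sub>C v) = c *\<^sub>C transition E i j x v"
    "transition E i j x (lact V a v) = lact V a (transition E i j x v)"
    "transition E i j x (ract V v b) = ract V (transition E i j x v) b"
proof -
  obtain T where T: "transition E i j x = blinfun_apply (T x)" "T x \<in> unitary_bimodule_maps V"
    using transition_eq_unitary[OF assms(1,2)] assms(3,4) by blast
  show "norm (transition E i j x v) = norm v"
    "transition E i j x (v + w) = transition E i j x v + transition E i j x w"
    "transition E i j x (v - w) = transition E i j x v - transition E i j x w"
    "transition E i j x (c *\<^sub>C v) = c *\<^sub>C transition E i j x v"
    "transition E i j x (lact V a v) = lact V a (transition E i j x v)"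
    "transition E i j x (ract V v b) = ract V (transition E i j x v) b"
    by (simp_all add: T(1) unitary_bimodule_map_isometry[OF T(2)] unitary_bimodule_map_linear[OF T(2)]
        blinfun.add_right blinfun.diff_right)
qed

text \<open>
  The fibre over \<open>x\<close> is identified with \<open>V\<close> by \<open>point x\<close> and \<open>coord x\<close>, using the
  chart that also defines its bimodule structure.  These coordinates jump with \<open>x\<close>;
  \<open>to_chart i x\<close> passes to the coordinates of the chart \<open>i\<close>, which depend continuously on \<open>x\<close>.
\<close>

definition point :: "'x \<Rightarrow> 'v \<Rightarrow> 'e" where
  "point x v = triv_inv E (chart_at E x) (x, v)"

definition coord :: "'x \<Rightarrow> 'e \<Rightarrow> 'v" where
  "coord x e = snd (triv E (chart_at E x) e)"

definition to_chart :: "'i \<Rightarrow> 'x \<Rightarrow> 'v \<Rightarrow> 'v" where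
  "to_chart i x = transition E (chart_at E x) i x"

lemma coord_point [simp]: "x \<in> topspace X \<Longrightarrow> coord x (point x v) = v"
  by (simp add: coord_def point_def triv_inv chart_at)

lemma point_in_total:
  assumes "x \<in> topspace X"
  shows "point x v \<in> topspace (total_space E)" "projection E (point x v) = x"
  using assms by (simp_all add: point_def triv_inv chart_at)

lemma point_coord:
  assumes "e \<in> topspace (total_space E)" "projection E e \<in> topspace X"
  shows "point (projection E e) (coord (projection E e) e) = e"
  using assms by (simp add: point_def coord_def triv_inv_triv chart_at)

lemma point_to_chart:
  assumes "i \<in> I" "x \<in> U i"
  shows "triv_inv E i (x, to_chart i x v) = point x v"
  using assms chart_at[OF nbhd_topspace[OF assms]] by (simp add: to_chart_def point_def triv_inv_transition)

lemma to_chart_bimodule_map: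
  assumes "i \<in> I" "x \<in> U i"
  shows "norm (to_chart i x v) = norm v"
    "to_chart i x (v + w) = to_chart i x v + to_chart i x w"
    "to_chart i x (v - w) = to_chart i x v - to_chart i x w"
    "to_chart i x (c *\<^sub>C v) = c *\<^sub>C to_chart i x v"
    "to_chart i x (lact V a v) = lact V a (to_chart i x v)"
    "to_chart i x (ract V v b) = ract V (to_chart i x v) b"
  using transition_bimodule_map[OF chart_at(1)[OF nbhd_topspace[OF assms]] assms(1)
      chart_at(2)[OF nbhd_topspace[OF assms]] assms(2)]
  by (simp_all add: to_chart_def)

lemma fibre_simps:
  "carrier (fibre V E x) = {e \<in> topspace (total_space E). projection E e = x}"
  "add (fibre V E x) e e' = point x (coord x e + coord x e')"
  "scl (fibre V E x) c e = point x (c *\<^sub>C coord x e)"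
  "nrm (fibre V E x) e = norm (coord x e)"
  "lact (fibre V E x) a e = point x (lact V a (coord x e))"
  "ract (fibre V E x) e b = point x (ract V (coord x e) b)"
  "rip (fibre V E x) e e' = rip V (coord x e) (coord x e')"
  by (simp_all add: fibre_def Let_def point_def coord_def add_V scl_V nrm_V)

definition continuous_section :: "('x \<Rightarrow> 'v) \<Rightarrow> bool" where
  "continuous_section s \<longleftrightarrow>
     (\<forall>i\<in>I. \<forall>x\<in>U i. ((\<lambda>y. to_chart i y (s y)) \<longlongrightarrow> to_chart i x (s x)) (atin X x))"

lemma continuous_section_iff:
  "continuous_section s \<longleftrightarrow>
    (\<forall>i\<in>I. continuous_map (subtopology X (U i)) euclidean (\<lambda>y. to_chart i y (s y)))"
  using open_nbhd by (auto simp: continuous_section_def continuous_map_open_subtopology_iff)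

lemma continuous_section_norm:
  assumes "continuous_section s"
  shows "continuous_map X euclideanreal (\<lambda>x. norm (s x))"
proof (rule pasting_lemma[where I = I and T = U and f = "\<lambda>i x. norm (s x)"])
  fix i assume i: "i \<in> I"
  then show "openin X (U i)" by (rule open_nbhd)
  have "continuous_map (subtopology X (U i)) euclideanreal (\<lambda>x. norm (to_chart i x (s x)))"
    using assms i by (intro continuous_map_norm) (simp add: continuous_section_iff)
  then show "continuous_map (subtopology X (U i)) euclideanreal (\<lambda>x. norm (s x))"
    by (rule continuous_map_eq) (use i in \<open>simp add: to_chart_bimodule_map\<close>)
qed (use cover in auto)

text \<open>
  As \<open>X\<close> is covered by the open sets \<open>U i\<close>, a section is continuous as soon as its
  restrictions to them are, and over \<open>U i\<close> the chart is a homeomorphism onto a product.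
\<close>

lemma continuous_map_total_iff:
  assumes \<sigma>: "\<And>x. x \<in> topspace X \<Longrightarrow> \<sigma> x \<in> topspace (total_space E)"
    "\<And>x. x \<in> topspace X \<Longrightarrow> projection E (\<sigma> x) = x"
  shows "continuous_map X (total_space E) \<sigma> \<longleftrightarrow> continuous_section (\<lambda>x. coord x (\<sigma> x))"
proof
  assume L: "continuous_map X (total_space E) \<sigma>"
  show "continuous_section (\<lambda>x. coord x (\<sigma> x))"
    unfolding continuous_section_iff
  proof
    fix i assume i: "i \<in> I"
    have "continuous_map (subtopology X (U i)) (subtopology (total_space E) (total_over i)) \<sigma>"
      using L \<sigma> nbhd_subset[OF i]
      by (auto simp: continuous_map_in_subtopology continuous_map_from_subtopology)
    moreover have "continuous_map (subtopology (total_space E) (total_over i))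
        (prod_topology (subtopology X (U i)) euclidean) (triv E i)"
      using triv_homeomorphic_maps[OF i] by (simp add: homeomorphic_maps_def)
    ultimately have "continuous_map (subtopology X (U i)) euclidean (snd \<circ> triv E i \<circ> \<sigma>)"
      by (meson continuous_map_compose continuous_map_snd)
    then show "continuous_map (subtopology X (U i)) euclidean (\<lambda>y. to_chart i y (coord y (\<sigma> y)))"
    proof (rule continuous_map_eq)
      fix x assume "x \<in> topspace (subtopology X (U i))"
      then have x: "x \<in> topspace X" "x \<in> U i" by simp_all
      have "to_chart i x (coord x (\<sigma> x)) = snd (triv E i (point x (coord x (\<sigma> x))))"
        by (simp add: to_chart_def point_def transition_def)
      also have "point x (coord x (\<sigma> x)) = \<sigma> x"
        using point_coord[of "\<sigma> x"] \<sigma>[of x] x by simp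
      finally show "(snd \<circ> triv E i \<circ> \<sigma>) x = to_chart i x (coord x (\<sigma> x))" by simp
    qed
  qed
next
  assume R: "continuous_section (\<lambda>x. coord x (\<sigma> x))"
  show "continuous_map X (total_space E) \<sigma>"
  proof (rule pasting_lemma[where I = I and T = U and f = "\<lambda>i. \<sigma>"])
    fix i assume i: "i \<in> I"
    then show "openin X (U i)" by (rule open_nbhd)
    have "continuous_map (subtopology X (U i)) (prod_topology (subtopology X (U i)) euclidean)
        (\<lambda>y. (y, to_chart i y (coord y (\<sigma> y))))"
      using R i by (auto simp: continuous_map_pairwise continuous_section_iff o_def)
    moreover have "continuous_map (prod_topology (subtopology X (U i)) euclidean)
        (subtopology (total_space E) (total_over i)) (triv_inv E i)"
      using triv_homeomorphic_maps[OF i] by (simp add: homeomorphic_maps_def)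
    ultimately have "continuous_map (subtopology X (U i)) (total_space E)
        (triv_inv E i \<circ> (\<lambda>y. (y, to_chart i y (coord y (\<sigma> y)))))"
      by (meson continuous_map_compose continuous_map_in_subtopology)
    then show "continuous_map (subtopology X (U i)) (total_space E) \<sigma>"
    proof (rule continuous_map_eq)
      fix x assume "x \<in> topspace (subtopology X (U i))"
      then show "(triv_inv E i \<circ> (\<lambda>y. (y, to_chart i y (coord y (\<sigma> y))))) x = \<sigma> x"
        using i \<sigma> point_coord[of "\<sigma> x"] by (simp add: point_to_chart)
    qed
  qed (use cover in auto)
qed

definition section_of :: "('x \<Rightarrow> 'v) \<Rightarrow> 'x \<Rightarrow> 'e" where
  "section_of s = (\<lambda>x\<in>topspace X. point x (s x))"

lemma section_of_apply: "x \<in> topspace X \<Longrightarrow> section_of s x = point x (s x)"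
  by (simp add: section_of_def)

lemma section_of_cong: "(\<And>x. x \<in> topspace X \<Longrightarrow> s x = t x) \<Longrightarrow> section_of s = section_of t"
  by (auto simp: section_of_def)

lemma continuous_section_cong:
  assumes "\<And>x. x \<in> topspace X \<Longrightarrow> s x = t x"
  shows "continuous_section s \<longleftrightarrow> continuous_section t"
  unfolding continuous_section_iff using assms
  by (intro ball_cong refl iffI; elim continuous_map_eq) simp_all

lemma section_of_in_C0_sections_iff:
  "section_of s \<in> carrier (C0_sections V E) \<longleftrightarrow>
     continuous_section s \<and> vanishes_at_infinity X (\<lambda>x. norm (s x))"
proof -
  have "continuous_map X (total_space E) (section_of s) \<longleftrightarrow> continuous_section s"
    using continuous_map_total_iff[of "section_of s"]
      continuous_section_cong[of "\<lambda>x. coord x (section_of s x)" s]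
    by (simp add: section_of_apply point_in_total)
  moreover have "vanishes_at_infinity X (\<lambda>x. nrm (fibre V E x) (section_of s x)) \<longleftrightarrow>
      vanishes_at_infinity X (\<lambda>x. norm (s x))"
    by (rule vanishes_at_infinity_cong) (simp add: section_of_apply fibre_simps)
  moreover have "section_of s \<in> extensional (topspace X)"
    by (simp add: section_of_def)
  ultimately show ?thesis
    by (simp add: C0_sections_def Let_def section_of_apply point_in_total)
qed

lemma C0_section_eq_section_of:
  assumes "\<sigma> \<in> carrier (C0_sections V E)"
  shows "\<sigma> = section_of (\<lambda>x. coord x (\<sigma> x))"
proof (rule extensionalityI[where A = "topspace X"])
  fix x assume x: "x \<in> topspace X"
  have "\<sigma> x \<in> topspace (total_space E)" "projection E (\<sigma> x) = x"
    using assms x by (auto simp: C0_sections_def Let_def continuous_map_def Pi_iff)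
  with x point_coord[of "\<sigma> x"] show "\<sigma> x = section_of (\<lambda>x. coord x (\<sigma> x)) x"
    by (simp add: section_of_apply)
qed (use assms in \<open>auto simp: C0_sections_def Let_def section_of_def\<close>)

lemma C0_sections_simps:
  "add (C0_sections V E) (section_of s) (section_of t) = section_of (\<lambda>x. s x + t x)"
  "scl (C0_sections V E) c (section_of s) = section_of (\<lambda>x. c *\<^sub>C s x)"
  "lact (C0_sections V E) \<alpha> (section_of s) = section_of (\<lambda>x. lact V (\<alpha> x) (s x))"
  "ract (C0_sections V E) (section_of s) \<beta> = section_of (\<lambda>x. ract V (s x) (\<beta> x))"
  by (auto simp: C0_sections_def Let_def section_of_def fibre_simps intro!: restrict_ext)

lemma coord_C0_sections:
  assumes "x \<in> topspace X"
  shows "coord x (add (C0_sections V E) \<sigma> \<tau> x) = coord x (\<sigma> x) + coord x (\<tau> x)"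
    "coord x (scl (C0_sections V E) c \<sigma> x) = c *\<^sub>C coord x (\<sigma> x)"
    "coord x (lact (C0_sections V E) \<alpha> \<sigma> x) = lact V (\<alpha> x) (coord x (\<sigma> x))"
    "coord x (ract (C0_sections V E) \<sigma> \<beta> x) = ract V (coord x (\<sigma> x)) (\<beta> x)"
  using assms by (simp_all add: C0_sections_def Let_def fibre_simps)

lemma C0_section_bounded:
  assumes "continuous_section s" "vanishes_at_infinity X (\<lambda>x. norm (s x))"
  obtains K where "\<And>x. x \<in> topspace X \<Longrightarrow> norm (s x) \<le> K"
  using vanishing_bounded[OF assms(2) continuous_section_norm[OF assms(1)]] by auto

lemma nrm_C0_sections:
  assumes "section_of s \<in> carrier (C0_sections V E)"
  shows "nrm (C0_sections V E) (section_of s) = sup_over X (\<lambda>x. norm (s x))"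
proof -
  obtain K where K: "\<And>x. x \<in> topspace X \<Longrightarrow> norm (s x) \<le> K"
    using assms C0_section_bounded unfolding section_of_in_C0_sections_iff by blast
  have "nrm (C0_sections V E) (section_of s) = sqrt (sup_over X (\<lambda>x. (norm (s x))\<^sup>2))"
    by (auto simp: C0_sections_def Let_def sup_over_def section_of_apply fibre_simps norm_rip_self
        intro!: arg_cong[where f = Sup] image_cong)
  also have "\<dots> = sup_over X (\<lambda>x. norm (s x))"
    using K by (intro sqrt_sup_over_square) auto
  finally show ?thesis .
qed

lemma norm_le_nrm_C0_sections:
  assumes "section_of s \<in> carrier (C0_sections V E)"
  shows "x \<in> topspace X \<Longrightarrow> norm (s x) \<le> nrm (C0_sections V E) (section_of s)"
    "0 \<le> nrm (C0_sections V E) (section_of s)"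
proof -
  obtain K where "\<And>x. x \<in> topspace X \<Longrightarrow> norm (s x) \<le> K"
    using assms C0_section_bounded unfolding section_of_in_C0_sections_iff by blast
  from sup_over_upper[of X "\<lambda>x. norm (s x)", OF this]
  show "x \<in> topspace X \<Longrightarrow> norm (s x) \<le> nrm (C0_sections V E) (section_of s)"
    "0 \<le> nrm (C0_sections V E) (section_of s)"
    unfolding nrm_C0_sections[OF assms] by blast+
qed

end

section \<open>Sections of the bundle of quasi-multipliers\<close>

lemma topspace_quotient_topology: "topspace (quotient_topology Z r) = topspace Z // r"
proof (rule antisym)
  show "topspace (quotient_topology Z r) \<subseteq> topspace Z // r"
    using openin_topspace[of "quotient_topology Z r"] unfolding openin_quotient_topology by simp
  have "{z \<in> topspace Z. r `` {z} \<in> topspace Z // r} = topspace Z"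
    by (auto intro: quotientI)
  then have "openin (quotient_topology Z r) (topspace Z // r)"
    unfolding openin_quotient_topology by simp
  then show "topspace Z // r \<subseteq> topspace (quotient_topology Z r)"
    by (rule openin_subset)
qed

lemma continuous_map_quotient_topology: "continuous_map Z (quotient_topology Z r) (\<lambda>z. r `` {z})"
  unfolding continuous_map_def topspace_quotient_topology openin_quotient_topology
  by (auto intro: quotientI)

context hilbert_bimodule_bundle
begin

lemma transition_QMV:
  assumes "i \<in> I" "j \<in> I" "x \<in> U i" "x \<in> U j" "q \<in> QMV"
  shows "transition E i j x \<circ> q \<in> QMV"
  using assms by (intro isometric_bimodule_map_QMV transition_bimodule_map)

lemma to_chart_QMV:
  assumes "i \<in> I" "x \<in> U i" "q \<in> QMV"
  shows "to_chart i x \<circ> q \<in> QMV"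
  using assms by (intro isometric_bimodule_map_QMV to_chart_bimodule_map)

lemma topspace_QM_coproduct:
  "topspace (QM_coproduct V E) = {(i, x, q). i \<in> I \<and> x \<in> U i \<and> q \<in> QMV}"
  by (auto simp: QM_coproduct_def nbhd_topspace)

lemma topspace_QM_bundle:
  "topspace (QM_bundle V E) = {QM_glue V E `` {(i, x, q)} | i x q. i \<in> I \<and> x \<in> U i \<and> q \<in> QMV}"
  by (auto simp: QM_bundle_def topspace_quotient_topology topspace_QM_coproduct quotient_def)

lemma QM_glue_class:
  assumes "i \<in> I" "x \<in> U i" "q \<in> QMV"
  shows "QM_glue V E `` {(i, x, q)} = {(j, x, transition E i j x \<circ> q) | j. j \<in> I \<and> x \<in> U j}"
  using assms by (auto simp: QM_glue_def)

lemma QM_glue_class_transition: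
  assumes "i \<in> I" "j \<in> I" "x \<in> U i" "x \<in> U j" "q \<in> QMV"
  shows "QM_glue V E `` {(j, x, transition E i j x \<circ> q)} = QM_glue V E `` {(i, x, q)}"
proof -
  have "transition E j k x \<circ> (transition E i j x \<circ> q) = transition E i k x \<circ> q"
    if "k \<in> I" "x \<in> U k" for k
    using assms that by (simp add: fun_eq_iff transition_transition)
  then show ?thesis
    using assms by (auto simp: QM_glue_class transition_QMV)
qed

definition QM_point :: "'x \<Rightarrow> ('a \<times> 'b \<Rightarrow> 'v) \<Rightarrow> ('i \<times> 'x \<times> ('a \<times> 'b \<Rightarrow> 'v)) set" where
  "QM_point x q = QM_glue V E `` {(chart_at E x, x, q)}"

text \<open>
  The class \<open>QM_point x q\<close> lists the expressions of one quasi-multiplier in all charts around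
  \<open>x\<close>.
\<close>

lemma QM_point_eq:
  assumes "x \<in> topspace X" "q \<in> QMV"
  shows "QM_point x q = {(j, x, to_chart j x \<circ> q) | j. j \<in> I \<and> x \<in> U j}"
  using assms chart_at[OF assms(1)] by (simp add: QM_point_def to_chart_def QM_glue_class)

lemma QM_point_to_chart:
  assumes "i \<in> I" "x \<in> U i" "q \<in> QMV"
  shows "QM_glue V E `` {(i, x, to_chart i x \<circ> q)} = QM_point x q"
  using assms chart_at[OF nbhd_topspace[OF assms(1,2)]]
  by (simp add: QM_point_def to_chart_def QM_glue_class_transition)

lemma QM_point_inj:
  assumes "x \<in> topspace X" "q \<in> QMV" "r \<in> QMV" "QM_point x q = QM_point x r"
  shows "q = r"
proof -
  have self: "to_chart (chart_at E x) x \<circ> q = q" for q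
    using chart_at[OF assms(1)] by (simp add: fun_eq_iff to_chart_def transition_self)
  have "(chart_at E x, x, q) \<in> QM_point x q"
    unfolding QM_point_eq[OF assms(1,2)] using chart_at[OF assms(1)] self[of q]
    by (auto intro!: exI[of _ "chart_at E x"])
  then have "(chart_at E x, x, q) \<in> QM_point x r"
    using assms by simp
  then show ?thesis
    unfolding QM_point_eq[OF assms(1,3)] using self[of r] by auto
qed

lemma QM_fibre_carrier_eq:
  assumes x: "x \<in> topspace X"
  shows "QM_fibre_carrier V E x = QM_point x ` QMV"
proof (intro equalityI subsetI)
  fix c assume "c \<in> QM_fibre_carrier V E x"
  then obtain i y q i' q' where c: "c = QM_glue V E `` {(i, y, q)}" "i \<in> I" "y \<in> U i" "q \<in> QMV"
    and "(i', x, q') \<in> c"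
    by (auto simp: QM_fibre_carrier_def topspace_QM_bundle)
  then have y: "y = x" by (auto simp: QM_glue_class)
  have "QM_point x (transition E i (chart_at E x) x \<circ> q) = c"
    using c(2-4) chart_at[OF x] unfolding QM_point_def c(1) y by (intro QM_glue_class_transition) simp_all
  moreover have "transition E i (chart_at E x) x \<circ> q \<in> QMV"
    using c chart_at[OF x] unfolding y by (intro transition_QMV) simp_all
  ultimately show "c \<in> QM_point x ` QMV" by blast
next
  fix c assume "c \<in> QM_point x ` QMV"
  then obtain q where q: "q \<in> QMV" "c = QM_point x q" by blast
  then have "c \<in> topspace (QM_bundle V E)"
    using chart_at[OF x] by (auto simp: QM_point_def topspace_QM_bundle)
  moreover have "\<exists>i q. (i, x, q) \<in> c"
    using chart_at[OF x] by (auto simp: q(2) QM_point_eq[OF x q(1)])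
  ultimately show "c \<in> QM_fibre_carrier V E x"
    by (simp add: QM_fibre_carrier_def)
qed

lemma QM_fibre_canonical_QM_point:
  assumes x: "x \<in> topspace X" and q: "q \<in> QMV"
  shows "QM_fibre_canonical E x (QM_point x q) = (\<lambda>z. point x (q z))"
  unfolding QM_fibre_canonical_def
proof (rule the_equality)
  have c: "chart_at E x \<in> I" "x \<in> U (chart_at E x)"
    using chart_at[OF x] by blast+
  then have "(chart_at E x, x, to_chart (chart_at E x) x \<circ> q) \<in> QM_point x q"
    unfolding QM_point_eq[OF x q] by blast
  moreover have "(\<lambda>z. point x (q z)) =
      (\<lambda>(a, b). triv_inv E (chart_at E x) (x, (to_chart (chart_at E x) x \<circ> q) (a, b)))"
    using c by (auto simp: fun_eq_iff point_to_chart)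
  ultimately show "\<exists>i q'. (i, x, q') \<in> QM_point x q \<and>
      (\<lambda>z. point x (q z)) = (\<lambda>(a, b). triv_inv E i (x, q' (a, b)))"
    by blast
next
  fix Q
  assume "\<exists>i q'. (i, x, q') \<in> QM_point x q \<and> Q = (\<lambda>(a, b). triv_inv E i (x, q' (a, b)))"
  then show "Q = (\<lambda>z. point x (q z))"
    unfolding QM_point_eq[OF x q] by (auto simp: fun_eq_iff point_to_chart)
qed

text \<open>
  The fibre operations are transported from the quasi-multipliers of \<open>fibre V E x\<close>, whose
  operations are in turn transported from \<open>V\<close> along the same chart; so the two transports cancel.
\<close>

lemma QM_fibre_simps:
  assumes x: "x \<in> topspace X" and q: "q \<in> QMV"
  shows "r \<in> QMV \<Longrightarrow> add (QM_fibre V E x) (QM_point x q) (QM_point x r) =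
      QM_point x (add (QM type_algebra type_algebra V) q r)"
    "scl (QM_fibre V E x) c (QM_point x q) = QM_point x (scl (QM type_algebra type_algebra V) c q)"
    "nrm (QM_fibre V E x) (QM_point x q) = nrm (QM type_algebra type_algebra V) q"
    "lact (QM_fibre V E x) a (QM_point x q) = QM_point x (lact (QM type_algebra type_algebra V) a q)"
    "ract (QM_fibre V E x) (QM_point x q) b = QM_point x (ract (QM type_algebra type_algebra V) q b)"
proof -
  let ?f = "QM_fibre_canonical E x"
  have inj: "inj_on ?f (QM_fibre_carrier V E x)"
  proof (rule inj_onI)
    fix c d assume "c \<in> QM_fibre_carrier V E x" "d \<in> QM_fibre_carrier V E x" and eq: "?f c = ?f d"
    then obtain s t where s: "s \<in> QMV" "c = QM_point x s" and t: "t \<in> QMV" "d = QM_point x t"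
      unfolding QM_fibre_carrier_eq[OF x] by blast
    have "(\<lambda>z. point x (s z)) = (\<lambda>z. point x (t z))"
      using eq by (simp add: s t QM_fibre_canonical_QM_point x)
    then have "s z = t z" for z
      using x coord_point[of x "s z"] coord_point[of x "t z"] by (metis (no_types))
    then have "s = t" by (rule ext)
    then show "c = d" by (simp add: s t)
  qed
  have g: "inv_into (QM_fibre_carrier V E x) ?f (\<lambda>z. point x (s z)) = QM_point x s"
    if "s \<in> QMV" for s
    using that by (intro inv_into_f_eq[OF inj])
      (simp_all add: QM_fibre_carrier_eq x QM_fibre_canonical_QM_point)
  show "nrm (QM_fibre V E x) (QM_point x q) = nrm (QM type_algebra type_algebra V) q"
    by (simp add: QM_fibre_def Let_def QM_fibre_canonical_QM_point x q nrm_QM fibre_simps nrm_V)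
  note closed = QM_V_closed[OF q]
  show "add (QM_fibre V E x) (QM_point x q) (QM_point x r) =
      QM_point x (add (QM type_algebra type_algebra V) q r)" if r: "r \<in> QMV"
    unfolding g[OF closed(1)[OF r], symmetric]
    by (simp add: QM_fibre_def Let_def QM_fibre_canonical_QM_point x q r QM_V_simps)
      (simp add: QM_def fibre_simps x case_prod_unfold restrict_UNIV)
  show "scl (QM_fibre V E x) c (QM_point x q) = QM_point x (scl (QM type_algebra type_algebra V) c q)"
    unfolding g[OF closed(2)[OF q], symmetric]
    by (simp add: QM_fibre_def Let_def QM_fibre_canonical_QM_point x q QM_V_simps)
      (simp add: QM_def fibre_simps x case_prod_unfold restrict_UNIV)
  show "lact (QM_fibre V E x) a (QM_point x q) = QM_point x (lact (QM type_algebra type_algebra V) a q)"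
    unfolding g[OF closed(3)[OF q], symmetric]
    by (simp add: QM_fibre_def Let_def QM_fibre_canonical_QM_point x q QM_V_simps)
      (simp add: QM_def fibre_simps x case_prod_unfold restrict_UNIV)
  show "ract (QM_fibre V E x) (QM_point x q) b = QM_point x (ract (QM type_algebra type_algebra V) q b)"
    unfolding g[OF closed(4)[OF q], symmetric]
    by (simp add: QM_fibre_def Let_def QM_fibre_canonical_QM_point x q QM_V_simps)
      (simp add: QM_def fibre_simps x case_prod_unfold restrict_UNIV)
qed

definition QM_section :: "('x \<Rightarrow> 'a \<times> 'b \<Rightarrow> 'v) \<Rightarrow> 'x \<Rightarrow> ('i \<times> 'x \<times> ('a \<times> 'b \<Rightarrow> 'v)) set" where
  "QM_section r = (\<lambda>x\<in>topspace X. QM_point x (r x))"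

lemma QM_section_apply: "x \<in> topspace X \<Longrightarrow> QM_section r x = QM_point x (r x)"
  by (simp add: QM_section_def)

text \<open>
  Evaluation at \<open>(a, b)\<close> in the chart \<open>i\<close> is continuous on the part of the quotient that lies
  over \<open>U i\<close>: on the summand of a chart \<open>j\<close> it is \<open>(x, q) \<mapsto> T\<^sub>j\<^sub>i(x) (q(a, b))\<close>, and the
  transition map \<open>T\<^sub>j\<^sub>i\<close> is norm continuous.
\<close>

lemma openin_QM_bundle_eval:
  assumes i: "i \<in> I" and W: "open W"
  shows "openin (QM_bundle V E)
    {c \<in> topspace (QM_bundle V E). \<exists>x q. (i, x, q) \<in> c \<and> q (a, b) \<in> W}" (is "openin _ ?O")
  unfolding QM_bundle_def openin_quotient_topology
proof
  show "{c \<in> topspace (quotient_topology (QM_coproduct V E) (QM_glue V E)).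
      \<exists>x q. (i, x, q) \<in> c \<and> q (a, b) \<in> W} \<subseteq> topspace (QM_coproduct V E) // QM_glue V E"
    by (auto simp: topspace_quotient_topology)
  define P where "P = {(j, x, q). j \<in> I \<and> x \<in> U j \<and> q \<in> QMV \<and> x \<in> U i \<and>
      transition E j i x (q (a, b)) \<in> W}"
  define Z where "Z = ?O"
  have "QM_glue V E `` {(j, x, q)} \<in> Z \<longleftrightarrow> x \<in> U i \<and> transition E j i x (q (a, b)) \<in> W"
    if "j \<in> I" "x \<in> U j" "q \<in> QMV" for j x q
  proof -
    have "QM_glue V E `` {(j, x, q)} \<in> topspace (QM_bundle V E)"
      unfolding topspace_QM_bundle using that by blast
    then show ?thesis
      unfolding Z_def using that i by (auto simp: QM_glue_class)
  qed
  then have "{z \<in> topspace (QM_coproduct V E). QM_glue V E `` {z} \<in> Z} = P"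
    by (auto simp: P_def topspace_QM_coproduct)
  moreover have "openin (QM_coproduct V E) P"
    unfolding QM_coproduct_def openin_sum_topology
  proof (intro conjI ballI)
    show "P \<subseteq> Sigma I (topspace \<circ> (\<lambda>i. prod_topology (subtopology X (U i))
        (quasi_strict_topology type_algebra type_algebra V)))"
      by (auto simp: P_def nbhd_topspace)
    fix j assume j: "j \<in> I"
    let ?Z = "prod_topology (subtopology X (U j)) (quasi_strict_topology type_algebra type_algebra V)"
    define N where "N = {y \<in> topspace ?Z. fst y \<in> U i}"
    have "openin (subtopology X (U j)) (U i \<inter> U j)"
      using open_nbhd i j by (auto simp: openin_open_subtopology)
    with continuous_map_fst
    have "openin ?Z {y \<in> topspace ?Z. fst y \<in> U i \<inter> U j}"
      by (rule openin_continuous_map_preimage)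
    moreover have "{y \<in> topspace ?Z. fst y \<in> U i \<inter> U j} = N"
      by (auto simp: N_def)
    ultimately have N: "openin ?Z N" by simp
    obtain T where T: "\<forall>x\<in>U j \<inter> U i. transition E j i x = blinfun_apply (T x) \<and> T x \<in> unitary_bimodule_maps V"
      "continuous_map (subtopology X (U j \<inter> U i)) euclidean T"
      using transition_eq_unitary[OF j i] by blast
    have "continuous_map (subtopology ?Z N) (subtopology X (U j \<inter> U i)) fst"
      using continuous_map_from_subtopology[OF continuous_map_fst, of "subtopology X (U j)"
          "quasi_strict_topology type_algebra type_algebra V" N]
      by (auto simp: continuous_map_in_subtopology N_def)
    from continuous_map_compose[OF this T(2)]
    have 1: "continuous_map (subtopology ?Z N) euclidean (\<lambda>y. T (fst y))"
      by (simp add: o_def)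
    have 2: "continuous_map (subtopology ?Z N) euclidean (\<lambda>y. snd y (a, b))"
      using continuous_map_compose[OF continuous_map_from_subtopology[OF continuous_map_snd]
          continuous_map_eval[of a b]] by (simp add: o_def)
    have "continuous_map (subtopology ?Z N) euclidean (\<lambda>y. T (fst y) (snd y (a, b)))"
      using 1 2 unfolding continuous_map_atin by (auto intro!: blinfun.tendsto)
    from openin_continuous_map_preimage[OF this, of W] W
    have "openin (subtopology ?Z N) {y \<in> topspace (subtopology ?Z N). T (fst y) (snd y (a, b)) \<in> W}"
      by simp
    then have "openin ?Z {y \<in> topspace (subtopology ?Z N). T (fst y) (snd y (a, b)) \<in> W}"
      using N by (simp add: openin_open_subtopology)
    moreover have "{y \<in> topspace (subtopology ?Z N). T (fst y) (snd y (a, b)) \<in> W} = {y. (j, y) \<in> P}"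
      using j by (auto simp: N_def P_def T nbhd_topspace)
    ultimately show "openin ?Z {y. (j, y) \<in> P}" by simp
  qed
  ultimately show "openin (QM_coproduct V E) {z \<in> topspace (QM_coproduct V E).
      QM_glue V E `` {z} \<in> {c \<in> topspace (quotient_topology (QM_coproduct V E) (QM_glue V E)).
      \<exists>x q. (i, x, q) \<in> c \<and> q (a, b) \<in> W}}"
    by (simp add: Z_def QM_bundle_def)
qed

text \<open>
  Over \<open>U i\<close> the section is the composition of \<open>x \<mapsto> (i, x, to_chart i x \<circ> r x)\<close> with
  the quotient map, which gives sufficiency; necessity is \<open>openin_QM_bundle_eval\<close>.
\<close>

lemma continuous_map_QM_section_iff:
  assumes r: "\<And>x. x \<in> topspace X \<Longrightarrow> r x \<in> QMV"
  shows "continuous_map X (QM_bundle V E) (QM_section r) \<longleftrightarrow>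
    (\<forall>a b. continuous_section (\<lambda>x. r x (a, b)))"
proof
  assume L: "continuous_map X (QM_bundle V E) (QM_section r)"
  show "\<forall>a b. continuous_section (\<lambda>x. r x (a, b))"
    unfolding continuous_section_iff
  proof (intro allI ballI)
    fix a b i assume i: "i \<in> I"
    have "openin (subtopology X (U i)) {x \<in> U i. to_chart i x (r x (a, b)) \<in> W}"
      if W: "open W" for W
    proof -
      let ?O = "{c \<in> topspace (QM_bundle V E). \<exists>x q. (i, x, q) \<in> c \<and> q (a, b) \<in> W}"
      have "openin X {x \<in> topspace X. QM_section r x \<in> ?O}"
        using L openin_QM_bundle_eval[OF i W] by (rule openin_continuous_map_preimage)
      moreover have "QM_section r x \<in> ?O \<longleftrightarrow> x \<in> U i \<and> to_chart i x (r x (a, b)) \<in> W"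
        if x: "x \<in> topspace X" for x
      proof -
        have "QM_section r x \<in> topspace (QM_bundle V E)"
          using L x by (auto dest: continuous_map_funspace)
        then show ?thesis
          using i by (auto simp: QM_section_apply[OF x] QM_point_eq[OF x r[OF x]])
      qed
      then have "{x \<in> topspace X. QM_section r x \<in> ?O} = {x \<in> U i. to_chart i x (r x (a, b)) \<in> W}"
        using nbhd_subset[OF i] by blast
      ultimately show ?thesis
        using open_nbhd[OF i] by (simp add: openin_open_subtopology)
    qed
    then show "continuous_map (subtopology X (U i)) euclidean (\<lambda>x. to_chart i x (r x (a, b)))"
      using nbhd_subset[OF i] by (simp add: continuous_map_def Int_absorb1)
  qed
next
  assume R: "\<forall>a b. continuous_section (\<lambda>x. r x (a, b))"
  show "continuous_map X (QM_bundle V E) (QM_section r)"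
  proof (rule pasting_lemma[where I = I and T = U and f = "\<lambda>i. QM_section r"])
    fix i assume i: "i \<in> I"
    then show "openin X (U i)" by (rule open_nbhd)
    let ?Z = "\<lambda>i. prod_topology (subtopology X (U i)) (quasi_strict_topology type_algebra type_algebra V)"
    have rU: "r x \<in> QMV" if "x \<in> U i" for x
      using r nbhd_topspace[OF i that] .
    have "continuous_map (subtopology X (U i)) (quasi_strict_topology type_algebra type_algebra V)
        (\<lambda>x. to_chart i x \<circ> r x)"
      unfolding continuous_map_quasi_strict_iff
      using R i rU by (auto simp: continuous_section_iff intro: to_chart_QMV)
    then have "continuous_map (subtopology X (U i)) (?Z i) (\<lambda>x. (x, to_chart i x \<circ> r x))"
      by (simp add: continuous_map_pairwise o_def)
    moreover have "continuous_map (?Z i) (QM_coproduct V E) (\<lambda>z. (i, z))"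
      unfolding QM_coproduct_def using i by (rule continuous_map_component_injection)
    moreover have "continuous_map (QM_coproduct V E) (QM_bundle V E) (\<lambda>z. QM_glue V E `` {z})"
      unfolding QM_bundle_def by (rule continuous_map_quotient_topology)
    ultimately have "continuous_map (subtopology X (U i)) (QM_bundle V E)
        ((\<lambda>z. QM_glue V E `` {z}) \<circ> ((\<lambda>z. (i, z)) \<circ> (\<lambda>x. (x, to_chart i x \<circ> r x))))"
      by (meson continuous_map_compose)
    then show "continuous_map (subtopology X (U i)) (QM_bundle V E) (QM_section r)"
      by (rule continuous_map_eq) (use i rU in \<open>auto simp: QM_section_apply QM_point_to_chart\<close>)
  qed (use cover in auto)
qed

abbreviation QM_norm :: "('a \<times> 'b \<Rightarrow> 'v) \<Rightarrow> real" where
  "QM_norm \<equiv> nrm (QM type_algebra type_algebra V)"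

text \<open>
  Both sides of the isomorphism are parametrised by these families: the bounded sections of
  \<open>QM_bundle V E\<close> by \<open>QM_section\<close>, and the quasi-multipliers of the module of sections by
  \<open>qm_of\<close> below.
\<close>

definition QM_families :: "('x \<Rightarrow> 'a \<times> 'b \<Rightarrow> 'v) set" where
  "QM_families = {r. (\<forall>x\<in>topspace X. r x \<in> QMV) \<and> (\<forall>a b. continuous_section (\<lambda>x. r x (a, b))) \<and>
     (\<exists>K. \<forall>x\<in>topspace X. QM_norm (r x) \<le> K)}"

lemma carrier_Cb_QM_sections: "carrier (Cb_QM_sections V E) = QM_section ` QM_families"
proof (intro equalityI subsetI)
  fix F assume F: "F \<in> carrier (Cb_QM_sections V E)"
  then have F': "F \<in> extensional (topspace X)" "continuous_map X (QM_bundle V E) F"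
    "\<forall>x\<in>topspace X. F x \<in> QM_point x ` QMV" "\<exists>K. \<forall>x\<in>topspace X. nrm (QM_fibre V E x) (F x) \<le> K"
    by (auto simp: Cb_QM_sections_def Let_def QM_fibre_carrier_eq QM_fibre_def)
  from F'(3) have "\<forall>x\<in>topspace X. \<exists>q. q \<in> QMV \<and> F x = QM_point x q"
    by blast
  from bchoice[OF this] obtain r where r: "\<And>x. x \<in> topspace X \<Longrightarrow> r x \<in> QMV"
    "\<And>x. x \<in> topspace X \<Longrightarrow> F x = QM_point x (r x)"
    by blast
  then have "F = QM_section r"
    using F'(1) by (intro extensionalityI[where A = "topspace X"]) (auto simp: QM_section_def)
  moreover have "\<exists>K. \<forall>x\<in>topspace X. QM_norm (r x) \<le> K"
    using F'(4) r by (simp add: QM_fibre_simps)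
  ultimately have "r \<in> QM_families"
    using F'(2) r(1) continuous_map_QM_section_iff[of r] by (simp add: QM_families_def)
  with \<open>F = QM_section r\<close> show "F \<in> QM_section ` QM_families" by blast
next
  fix F assume "F \<in> QM_section ` QM_families"
  then obtain r where r: "\<And>x. x \<in> topspace X \<Longrightarrow> r x \<in> QMV" "F = QM_section r"
    "\<forall>a b. continuous_section (\<lambda>x. r x (a, b))" "\<exists>K. \<forall>x\<in>topspace X. QM_norm (r x) \<le> K"
    by (auto simp: QM_families_def)
  have "continuous_map X (QM_bundle V E) F"
    using r continuous_map_QM_section_iff[of r] by simp
  moreover have "F x \<in> carrier (QM_fibre V E x)" if "x \<in> topspace X" for x
    using that r by (simp add: QM_fibre_def Let_def QM_fibre_carrier_eq QM_section_apply)
  moreover have "\<exists>K. \<forall>x\<in>topspace X. nrm (QM_fibre V E x) (F x) \<le> K"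
    using r by (simp add: QM_fibre_simps QM_section_apply)
  ultimately show "F \<in> carrier (Cb_QM_sections V E)"
    by (simp add: Cb_QM_sections_def Let_def) (simp add: r QM_section_def)
qed

lemma Cb_QM_sections_simps:
  assumes "\<And>x. x \<in> topspace X \<Longrightarrow> r x \<in> QMV" "\<And>x. x \<in> topspace X \<Longrightarrow> s x \<in> QMV"
  shows "add (Cb_QM_sections V E) (QM_section r) (QM_section s) =
      QM_section (\<lambda>x. add (QM type_algebra type_algebra V) (r x) (s x))"
    "scl (Cb_QM_sections V E) c (QM_section r) =
      QM_section (\<lambda>x. scl (QM type_algebra type_algebra V) c (r x))"
    "nrm (Cb_QM_sections V E) (QM_section r) = sup_over X (\<lambda>x. QM_norm (r x))"
    "lact (Cb_QM_sections V E) \<alpha> (QM_section r) =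
      QM_section (\<lambda>x. lact (QM type_algebra type_algebra V) (\<alpha> x) (r x))"
    "ract (Cb_QM_sections V E) (QM_section r) \<beta> =
      QM_section (\<lambda>x. ract (QM type_algebra type_algebra V) (r x) (\<beta> x))"
  using assms
  by (auto simp: Cb_QM_sections_def Let_def QM_section_def QM_fibre_simps sup_over_def
      intro!: restrict_ext arg_cong[where f = Sup] image_cong)

end

section \<open>Cut-off functions\<close>

text \<open>
  The cut-off \<open>\<phi> = max 0 (1 - \<parallel>\<alpha>\<parallel> / \<epsilon>)\<close> equals \<open>1\<close> where \<open>\<alpha>\<close> vanishes, and
  \<open>\<parallel>\<phi>\<alpha>\<parallel> \<le> \<epsilon>\<close> because \<open>\<phi>\<close> vanishes where \<open>\<parallel>\<alpha>\<parallel> \<ge> \<epsilon>\<close>.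
\<close>

lemma cutoff_near_zero:
  fixes \<alpha> :: "'x \<Rightarrow> 'c::cstar_algebra" and X :: "'x topology"
  assumes \<alpha>: "\<alpha> \<in> carrier (C0 X)" and x: "\<alpha> x = 0" and \<epsilon>: "0 < \<epsilon>"
  shows "\<exists>\<phi>. continuous_map X euclideanreal \<phi> \<and> (\<forall>y\<in>topspace X. \<bar>\<phi> y\<bar> \<le> 1) \<and> \<phi> x = 1 \<and>
    nrm (C0 X) (\<lambda>y\<in>topspace X. \<phi> y *\<^sub>R \<alpha> y) \<le> \<epsilon>"
proof (intro exI conjI)
  let ?\<phi> = "\<lambda>y. max 0 (1 - norm (\<alpha> y) / \<epsilon>)"
  have "(?\<phi> \<longlongrightarrow> ?\<phi> y) (atin X y)" if "y \<in> topspace X" for y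
    using C0_tendsto[OF \<alpha> that] \<epsilon> by (intro tendsto_intros) auto
  then show "continuous_map X euclideanreal ?\<phi>"
    by (simp add: continuous_map_atin)
  show "\<forall>y\<in>topspace X. \<bar>?\<phi> y\<bar> \<le> 1"
    using \<epsilon> by auto
  show "?\<phi> x = 1" by (simp add: x)
  show "nrm (C0 X) (\<lambda>y\<in>topspace X. ?\<phi> y *\<^sub>R \<alpha> y) \<le> \<epsilon>"
  proof (rule nrm_C0_least)
    fix y assume y: "y \<in> topspace X"
    have "?\<phi> y * norm (\<alpha> y) \<le> \<epsilon>"
    proof (cases "norm (\<alpha> y) \<le> \<epsilon>")
      case True
      then have "?\<phi> y * norm (\<alpha> y) \<le> 1 * \<epsilon>"
        using \<epsilon> by (intro mult_mono) auto
      then show ?thesis by simp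
    next
      case False
      then have "?\<phi> y = 0" using \<epsilon> by (simp add: max_def field_simps)
      with \<epsilon> show ?thesis by simp
    qed
    with y show "norm ((\<lambda>y\<in>topspace X. ?\<phi> y *\<^sub>R \<alpha> y) y) \<le> \<epsilon>" by simp
  qed (use \<epsilon> in simp)
qed



text \<open>
  Local compactness and complete regularity give a plateau function near any point.  Multiplied by
  \<open>c\<close>, it gives a function vanishing at infinity that is constantly \<open>c\<close> near that point.
\<close>

lemma exists_bump:
  assumes X: "locally_compact_space X" "Hausdorff_space X" and x: "x \<in> topspace X"
  obtains \<phi> U where "continuous_map X euclideanreal \<phi>" "vanishes_at_infinity X \<phi>"
    "\<And>y. 0 \<le> \<phi> y" "\<And>y. \<phi> y \<le> 1" "openin X U" "x \<in> U" "\<And>y. y \<in> U \<Longrightarrow> \<phi> y = 1"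
proof -
  obtain W K where W: "openin X W" "compactin X K" "x \<in> W" "W \<subseteq> K"
    using X x unfolding locally_compact_space_def by blast
  have "completely_regular_space X"
    using X by (intro locally_compact_regular_imp_completely_regular_space) simp_all
  then obtain f where f: "continuous_map X euclideanreal f" "f x = 0" "f ` (topspace X - W) \<subseteq> {1}"
    using completely_regular_space_alt'[THEN iffD1, rule_format, OF _ W(1,3)] by metis
  \<comment> \<open>The factor 2 turns the peak \<open>1 - f\<close> into a plateau on the set where \<open>f < 1/2\<close>.\<close>
  define \<phi> where "\<phi> = (\<lambda>y. max 0 (min 1 (2 * (1 - f y))))"
  have c: "continuous_map X euclideanreal \<phi>"
    unfolding \<phi>_def using f(1)
    by (intro continuous_map_real_max continuous_map_real_min continuous_map_real_mult
        continuous_map_diff continuous_map_const[THEN iffD2]) auto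
  have "f y = 1" if "y \<in> topspace X - K" for y
    using f(3) W(4) that by blast
  then have "\<phi> y = 0" if "y \<in> topspace X - K" for y
    using that by (simp add: \<phi>_def)
  then have v: "vanishes_at_infinity X \<phi>"
    unfolding vanishes_at_infinity_def using W(2) by auto
  show thesis
  proof (rule that[OF c v])
    show "openin X {y \<in> topspace X. f y \<in> {..<1/2}}"
      using f(1) by (intro openin_continuous_map_preimage[where Y = euclidean]) auto
  qed (use x f(2) in \<open>auto simp: \<phi>_def\<close>)
qed

definition bump :: "'x topology \<Rightarrow> 'x \<Rightarrow> 'x \<Rightarrow> real" where
  "bump X x = (SOME \<phi>. continuous_map X euclideanreal \<phi> \<and> vanishes_at_infinity X \<phi> \<and>
     (\<forall>y. 0 \<le> \<phi> y \<and> \<phi> y \<le> 1) \<and> (\<exists>N. openin X N \<and> x \<in> N \<and> (\<forall>y\<in>N. \<phi> y = 1)))"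

definition constant_near :: "'x topology \<Rightarrow> 'x \<Rightarrow> 'c::cstar_algebra \<Rightarrow> 'x \<Rightarrow> 'c" where
  "constant_near X x c = (\<lambda>y\<in>topspace X. bump X x y *\<^sub>R c)"

context
  fixes X :: "'x topology" and x :: 'x
  assumes X: "locally_compact_space X" "Hausdorff_space X" and x: "x \<in> topspace X"
begin

lemma bump: "continuous_map X euclideanreal (bump X x)" "vanishes_at_infinity X (bump X x)"
    "0 \<le> bump X x y" "bump X x y \<le> 1" "\<exists>N. openin X N \<and> x \<in> N \<and> (\<forall>y\<in>N. bump X x y = 1)"
proof -
  have "\<exists>\<phi>. continuous_map X euclideanreal \<phi> \<and> vanishes_at_infinity X \<phi> \<and>
     (\<forall>y. 0 \<le> \<phi> y \<and> \<phi> y \<le> 1) \<and> (\<exists>N. openin X N \<and> x \<in> N \<and> (\<forall>y\<in>N. \<phi> y = 1))"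
    by (rule exists_bump[OF X x]) blast
  from someI_ex[OF this, folded bump_def]
  show "continuous_map X euclideanreal (bump X x)" "vanishes_at_infinity X (bump X x)"
    "0 \<le> bump X x y" "bump X x y \<le> 1" "\<exists>N. openin X N \<and> x \<in> N \<and> (\<forall>y\<in>N. bump X x y = 1)"
    by blast+
qed

lemma constant_near_C0: "constant_near X x c \<in> carrier (C0 X)"
  unfolding constant_near_def
proof (rule restrict_in_C0I)
  show "((\<lambda>y. bump X x y *\<^sub>R c) \<longlongrightarrow> bump X x z *\<^sub>R c) (atin X z)" if "z \<in> topspace X" for z
    using that bump(1) by (intro tendsto_scaleR tendsto_const) (auto simp: continuous_map_atin)
  show "vanishes_at_infinity X (\<lambda>y. norm (bump X x y *\<^sub>R c))"
    using bump(2) by (rule vanishes_at_infinity_mono[where C = "norm c"]) (simp add: mult.commute)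
qed

lemma constant_near_eq: "\<exists>N. openin X N \<and> x \<in> N \<and> (\<forall>y\<in>N. \<forall>c. constant_near X x c y = c)"
proof -
  obtain N where N: "openin X N" "x \<in> N" "\<forall>y\<in>N. bump X x y = 1"
    using bump(5) by blast
  with openin_subset[OF N(1)] show ?thesis
    by (intro exI[of _ N]) (auto simp: constant_near_def)
qed

lemma constant_near_self [simp]: "constant_near X x c x = c"
  using constant_near_eq by blast

lemma nrm_constant_near: "nrm (C0 X) (constant_near X x c) \<le> norm c"
  by (rule nrm_C0_least) (auto simp: constant_near_def bump abs_of_nonneg intro: mult_left_le_one_le)

end

section \<open>Quasi-multipliers of the module of sections\<close>

locale hilbert_bimodule_bundle_lch = hilbert_bimodule_bundle V E
  for V :: "('a::cstar_algebra, 'b::cstar_algebra, 'v::complex_banach) hbimodule"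
    and E :: "('i, 'x, 'e, 'v) fibre_bundle" +
  assumes locally_compact: "locally_compact_space (base_space E)"
    and Hausdorff_base: "Hausdorff_space (base_space E)"
begin

abbreviation "A\<^sub>0 \<equiv> C0 X :: ('x \<Rightarrow> 'a) star_algebra"
abbreviation "B\<^sub>0 \<equiv> C0 X :: ('x \<Rightarrow> 'b) star_algebra"
abbreviation "V\<^sub>0 \<equiv> C0_sections V E"
abbreviation "QM\<^sub>V \<equiv> QM type_algebra type_algebra V"

lemmas near = constant_near_C0[OF locally_compact Hausdorff_base]
  constant_near_self[OF locally_compact Hausdorff_base]

lemma QM_families_bound:
  assumes "r \<in> QM_families"
  obtains K where "0 \<le> K" "\<And>x a b. x \<in> topspace X \<Longrightarrow> norm (r x (a, b)) \<le> K * norm a * norm b"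
proof -
  obtain K where K: "\<forall>x\<in>topspace X. QM_norm (r x) \<le> K" and r: "\<forall>x\<in>topspace X. r x \<in> QMV"
    using assms by (auto simp: QM_families_def)
  have "norm (r x (a, b)) \<le> max 0 K * norm a * norm b" if "x \<in> topspace X" for x a b
    using K r that by (intro norm_QMV_le) (auto simp: le_max_iff_disj)
  then show thesis
    by (intro that[of "max 0 K"]) auto
qed

text \<open>
  The family is continuous only at fixed arguments, but uniformly bounded, and so it may be
  evaluated at arguments that vary continuously.
\<close>

lemma continuous_section_eval:
  assumes r: "r \<in> QM_families" and \<alpha>: "\<alpha> \<in> carrier A\<^sub>0" and \<beta>: "\<beta> \<in> carrier B\<^sub>0"
  shows "continuous_section (\<lambda>x. r x (\<alpha> x, \<beta> x))"
  unfolding continuous_section_def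
proof (intro ballI)
  fix i x assume i: "i \<in> I" and x: "x \<in> U i"
  then have xX: "x \<in> topspace X" by (rule nbhd_topspace)
  obtain K where K: "0 \<le> K" "\<And>x a b. x \<in> topspace X \<Longrightarrow> norm (r x (a, b)) \<le> K * norm a * norm b"
    using QM_families_bound[OF r] by blast
  let ?f = "\<lambda>y. to_chart i y (r y (\<alpha> y, \<beta> y))" and ?g = "\<lambda>y. to_chart i y (r y (\<alpha> x, \<beta> x))"
  let ?h = "\<lambda>y. K * norm (\<alpha> y - \<alpha> x) * norm (\<beta> y) + K * norm (\<alpha> x) * norm (\<beta> y - \<beta> x)"
  have "(\<alpha> \<longlongrightarrow> \<alpha> x) (atin X x)" "(\<beta> \<longlongrightarrow> \<beta> x) (atin X x)"
    using \<alpha> \<beta> xX by (auto intro: C0_tendsto)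
  then have "(?h \<longlongrightarrow> K * norm (\<alpha> x - \<alpha> x) * norm (\<beta> x) + K * norm (\<alpha> x) * norm (\<beta> x - \<beta> x)) (atin X x)"
    by (intro tendsto_intros)
  then have h: "(?h \<longlongrightarrow> 0) (atin X x)" by simp
  have bound: "norm (?f y - ?g y) \<le> ?h y" if y: "y \<in> U i" for y
  proof -
    have yX: "y \<in> topspace X" using i y by (rule nbhd_topspace)
    then have ry: "r y \<in> QMV" using r by (simp add: QM_families_def)
    have "norm (?f y - ?g y) = norm (r y (\<alpha> y, \<beta> y) - r y (\<alpha> x, \<beta> x))"
      by (simp only: to_chart_bimodule_map(1) to_chart_bimodule_map(3)[symmetric] i y)
    also have "\<dots> = norm (r y (\<alpha> y - \<alpha> x, \<beta> y) + r y (\<alpha> x, \<beta> y - \<beta> x))"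
      by (simp add: QMV_diff[OF ry])
    also have "\<dots> \<le> ?h y"
      by (intro norm_triangle_le add_mono K(2)[OF yX])
    finally show ?thesis .
  qed
  have "eventually (\<lambda>y. norm (?f y - ?g y) \<le> ?h y) (atin X x)"
    unfolding eventually_atin using bound open_nbhd[OF i] x by blast
  then have fg: "((\<lambda>y. ?f y - ?g y) \<longlongrightarrow> 0) (atin X x)"
    using h by (rule Lim_null_comparison)
  have "continuous_section (\<lambda>y. r y (\<alpha> x, \<beta> x))"
    using r by (simp add: QM_families_def)
  then have "(?g \<longlongrightarrow> ?g x) (atin X x)"
    using i x unfolding continuous_section_def by blast
  then show "(?f \<longlongrightarrow> ?f x) (atin X x)"
    using fg by (rule Lim_transform)
qed

definition qm_of :: "('x \<Rightarrow> 'a \<times> 'b \<Rightarrow> 'v) \<Rightarrow> ('x \<Rightarrow> 'a) \<times> ('x \<Rightarrow> 'b) \<Rightarrow> 'x \<Rightarrow> 'e" where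
  "qm_of r = (\<lambda>(\<alpha>, \<beta>) \<in> carrier A\<^sub>0 \<times> carrier B\<^sub>0. section_of (\<lambda>x. r x (\<alpha> x, \<beta> x)))"

lemma qm_of_apply:
  "\<alpha> \<in> carrier A\<^sub>0 \<Longrightarrow> \<beta> \<in> carrier B\<^sub>0 \<Longrightarrow> qm_of r (\<alpha>, \<beta>) = section_of (\<lambda>x. r x (\<alpha> x, \<beta> x))"
  by (simp add: qm_of_def)

lemma qm_of_cong:
  assumes "\<And>x. x \<in> topspace X \<Longrightarrow> r x = s x"
  shows "qm_of r = qm_of s"
  unfolding qm_of_def using assms by (auto intro!: restrict_ext section_of_cong)

lemma qm_of_in_sections:
  assumes r: "r \<in> QM_families" and \<alpha>: "\<alpha> \<in> carrier A\<^sub>0" and \<beta>: "\<beta> \<in> carrier B\<^sub>0"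
  shows "section_of (\<lambda>x. r x (\<alpha> x, \<beta> x)) \<in> carrier V\<^sub>0"
proof -
  obtain K where K: "0 \<le> K" "\<And>x a b. x \<in> topspace X \<Longrightarrow> norm (r x (a, b)) \<le> K * norm a * norm b"
    using QM_families_bound[OF r] by blast
  obtain L where L: "\<And>x. x \<in> topspace X \<Longrightarrow> norm (\<beta> x) \<le> L"
    using C0_bounded[OF \<beta>] by metis
  have bound: "norm (r x (\<alpha> x, \<beta> x)) \<le> K * L * norm (\<alpha> x)" if "x \<in> topspace X" for x
    using K(2)[OF that, of "\<alpha> x" "\<beta> x"] mult_left_mono[OF L[OF that], of "K * norm (\<alpha> x)"] K(1)
    by (simp add: mult_ac)
  have "vanishes_at_infinity X (\<lambda>x. norm (\<alpha> x))"
    using \<alpha> by (simp add: carrier_C0_iff)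
  then have "vanishes_at_infinity X (\<lambda>x. norm (r x (\<alpha> x, \<beta> x)))"
    by (rule vanishes_at_infinity_mono[where C = "K * L"]) (use bound in simp)
  then show ?thesis
    using continuous_section_eval[OF r \<alpha> \<beta>] by (simp add: section_of_in_C0_sections_iff)
qed

lemma qm_of_in_QM:
  assumes r: "r \<in> QM_families"
  shows "qm_of r \<in> quasi_multipliers A\<^sub>0 B\<^sub>0 V\<^sub>0"
proof -
  have rD: "r x \<in> QMV" if "x \<in> topspace X" for x
    using r that by (simp add: QM_families_def)
  obtain K where K: "0 \<le> K" "\<And>x a b. x \<in> topspace X \<Longrightarrow> norm (r x (a, b)) \<le> K * norm a * norm b"
    using QM_families_bound[OF r] by blast
  have bound: "nrm V\<^sub>0 (qm_of r (\<alpha>, \<beta>)) \<le> K * nrm A\<^sub>0 \<alpha> * nrm B\<^sub>0 \<beta>"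
    if \<alpha>: "\<alpha> \<in> carrier A\<^sub>0" and \<beta>: "\<beta> \<in> carrier B\<^sub>0" for \<alpha> \<beta>
    unfolding qm_of_apply[OF \<alpha> \<beta>] nrm_C0_sections[OF qm_of_in_sections[OF r \<alpha> \<beta>]]
  proof (rule sup_over_least)
    show "0 \<le> K * nrm A\<^sub>0 \<alpha> * nrm B\<^sub>0 \<beta>"
      using K(1) nrm_C0_nonneg[OF \<alpha>] nrm_C0_nonneg[OF \<beta>] by (simp del: C0_simps)
    fix x assume x: "x \<in> topspace X"
    have "K * norm (\<alpha> x) * norm (\<beta> x) \<le> K * nrm A\<^sub>0 \<alpha> * nrm B\<^sub>0 \<beta>"
      using K(1) norm_le_nrm_C0[OF \<alpha> x] norm_le_nrm_C0[OF \<beta> x] nrm_C0_nonneg[OF \<alpha>]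
      by (intro mult_mono) (simp_all del: C0_simps)
    with K(2)[OF x] show "norm (r x (\<alpha> x, \<beta> x)) \<le> K * nrm A\<^sub>0 \<alpha> * nrm B\<^sub>0 \<beta>"
      by (rule order_trans)
  qed
  have [simp]: "(\<lambda>x\<in>topspace X. f x + g x) \<in> carrier (C0 X)" "(\<lambda>x\<in>topspace X. c *\<^sub>C f x) \<in> carrier (C0 X)"
    "(\<lambda>x\<in>topspace X. f x * g x) \<in> carrier (C0 X)"
    if "f \<in> carrier (C0 X)" "g \<in> carrier (C0 X)" for f g :: "'x \<Rightarrow> 'c::cstar_algebra" and c
    using C0_add[OF that] C0_scl[OF that(1)] C0_mul[OF that] by simp_all
  show ?thesis
    unfolding quasi_multipliers_def
  proof (intro CollectI conjI ballI allI)
    show "qm_of r \<in> carrier A\<^sub>0 \<times> carrier B\<^sub>0 \<rightarrow>\<^sub>E carrier V\<^sub>0"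
      using qm_of_in_sections[OF r] by (auto simp: qm_of_def)
    show "\<exists>K. \<forall>\<alpha>\<in>carrier A\<^sub>0. \<forall>\<beta>\<in>carrier B\<^sub>0. nrm V\<^sub>0 (qm_of r (\<alpha>, \<beta>)) \<le> K * nrm A\<^sub>0 \<alpha> * nrm B\<^sub>0 \<beta>"
      using bound by blast
  qed (auto simp: qm_of_apply C0_sections_simps QMV_D[OF rD] intro!: section_of_cong)
qed

text \<open>
  This recovers a family \<open>r\<close> from \<open>q = qm_of r\<close>: \<open>q\<close> is evaluated on functions with the values \<open>a\<close> and \<open>b\<close> at
  \<open>x\<close>.  Other functions with these values give the same result, see \<open>val_cong\<close> below.
\<close>

definition fibre_qm :: "(('x \<Rightarrow> 'a) \<times> ('x \<Rightarrow> 'b) \<Rightarrow> 'x \<Rightarrow> 'e) \<Rightarrow> 'x \<Rightarrow> 'a \<times> 'b \<Rightarrow> 'v" where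
  "fibre_qm q x = (\<lambda>(a, b). coord x (q (constant_near X x a, constant_near X x b) x))"

lemma fibre_qm_qm_of:
  assumes "x \<in> topspace X"
  shows "fibre_qm (qm_of r) x = r x"
  using assms by (auto simp: fibre_qm_def qm_of_apply near section_of_apply)

context
  fixes q :: "('x \<Rightarrow> 'a) \<times> ('x \<Rightarrow> 'b) \<Rightarrow> 'x \<Rightarrow> 'e"
  assumes q: "q \<in> quasi_multipliers A\<^sub>0 B\<^sub>0 V\<^sub>0"
begin

abbreviation (input) val :: "('x \<Rightarrow> 'a) \<Rightarrow> ('x \<Rightarrow> 'b) \<Rightarrow> 'x \<Rightarrow> 'v" where
  "val \<alpha> \<beta> x \<equiv> coord x (q (\<alpha>, \<beta>) x)"

lemma q_section:
  assumes "\<alpha> \<in> carrier A\<^sub>0" "\<beta> \<in> carrier B\<^sub>0"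
  shows "q (\<alpha>, \<beta>) \<in> carrier V\<^sub>0" "q (\<alpha>, \<beta>) = section_of (val \<alpha> \<beta>)"
proof -
  show "q (\<alpha>, \<beta>) \<in> carrier V\<^sub>0"
    using q assms by (rule quasi_multipliersD)
  then show "q (\<alpha>, \<beta>) = section_of (val \<alpha> \<beta>)"
    by (rule C0_section_eq_section_of)
qed

lemma val_continuous:
  assumes "\<alpha> \<in> carrier A\<^sub>0" "\<beta> \<in> carrier B\<^sub>0"
  shows "continuous_section (val \<alpha> \<beta>)" "vanishes_at_infinity X (\<lambda>x. norm (val \<alpha> \<beta> x))"
  using q_section[OF assms] by (metis section_of_in_C0_sections_iff)+

lemma val_bound:
  obtains K where "0 \<le> K" "\<And>\<alpha> \<beta> x. \<lbrakk>\<alpha> \<in> carrier A\<^sub>0; \<beta> \<in> carrier B\<^sub>0; x \<in> topspace X\<rbrakk> \<Longrightarrow>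
    norm (val \<alpha> \<beta> x) \<le> K * nrm A\<^sub>0 \<alpha> * nrm B\<^sub>0 \<beta>"
proof -
  obtain K where K: "\<And>\<alpha> \<beta>. \<lbrakk>\<alpha> \<in> carrier A\<^sub>0; \<beta> \<in> carrier B\<^sub>0\<rbrakk> \<Longrightarrow>
      nrm V\<^sub>0 (q (\<alpha>, \<beta>)) \<le> K * nrm A\<^sub>0 \<alpha> * nrm B\<^sub>0 \<beta>"
    using quasi_multipliersD(7)[OF q] by blast
  have "norm (val \<alpha> \<beta> x) \<le> \<bar>K\<bar> * nrm A\<^sub>0 \<alpha> * nrm B\<^sub>0 \<beta>"
    if \<alpha>: "\<alpha> \<in> carrier A\<^sub>0" and \<beta>: "\<beta> \<in> carrier B\<^sub>0" and x: "x \<in> topspace X" for \<alpha> \<beta> x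
  proof -
    have "norm (val \<alpha> \<beta> x) \<le> nrm V\<^sub>0 (section_of (val \<alpha> \<beta>))"
      using q_section[OF \<alpha> \<beta>] x by (intro norm_le_nrm_C0_sections) simp_all
    also have "\<dots> = nrm V\<^sub>0 (q (\<alpha>, \<beta>))"
      using q_section(2)[OF \<alpha> \<beta>] by simp
    also have "\<dots> \<le> K * nrm A\<^sub>0 \<alpha> * nrm B\<^sub>0 \<beta>"
      using \<alpha> \<beta> by (rule K)
    also have "\<dots> \<le> \<bar>K\<bar> * nrm A\<^sub>0 \<alpha> * nrm B\<^sub>0 \<beta>"
      using nrm_C0_nonneg[OF \<alpha>] nrm_C0_nonneg[OF \<beta>]
      by (intro mult_right_mono) (simp_all del: C0_simps)
    finally show ?thesis .
  qed
  then show thesis by (intro that[of "\<bar>K\<bar>"]) simp_all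
qed

lemma val_linear:
  assumes "\<alpha> \<in> carrier A\<^sub>0" "\<beta> \<in> carrier B\<^sub>0" and x: "x \<in> topspace X"
  shows "\<alpha>' \<in> carrier A\<^sub>0 \<Longrightarrow> val (add A\<^sub>0 \<alpha> \<alpha>') \<beta> x = val \<alpha> \<beta> x + val \<alpha>' \<beta> x"
    "\<beta>' \<in> carrier B\<^sub>0 \<Longrightarrow> val \<alpha> (add B\<^sub>0 \<beta> \<beta>') x = val \<alpha> \<beta> x + val \<alpha> \<beta>' x"
    "val (scl A\<^sub>0 c \<alpha>) \<beta> x = c *\<^sub>C val \<alpha> \<beta> x"
    "val \<alpha> (scl B\<^sub>0 c \<beta>) x = c *\<^sub>C val \<alpha> \<beta> x"
    "\<lbrakk>\<gamma> \<in> carrier A\<^sub>0; \<delta> \<in> carrier B\<^sub>0\<rbrakk> \<Longrightarrow>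
      val (mul A\<^sub>0 \<gamma> \<alpha>) (mul B\<^sub>0 \<beta> \<delta>) x = lact V (\<gamma> x) (ract V (val \<alpha> \<beta> x) (\<delta> x))"
  using assms
  by (simp_all only: quasi_multipliersD(3-6,8)[OF q] coord_C0_sections)

text \<open>
  A quasi-multiplier commutes with bounded continuous scalar functions \<open>\<phi>\<close>, \<open>\<psi>\<close>: multiplying
  \<open>q(\<phi>\<alpha>, \<psi>\<beta>)\<close> by \<open>\<gamma>\<close> and \<open>\<delta>\<close> moves the scalar functions to \<open>\<gamma>\<phi>\<close> and \<open>\<psi>\<delta>\<close>,
  and \<open>V\<close> is nondegenerate on both sides.
\<close>

lemma val_scaleR:
  assumes \<alpha>: "\<alpha> \<in> carrier A\<^sub>0" and \<beta>: "\<beta> \<in> carrier B\<^sub>0" and x: "x \<in> topspace X"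
    and \<phi>: "continuous_map X euclideanreal \<phi>" "\<And>y. y \<in> topspace X \<Longrightarrow> \<bar>\<phi> y\<bar> \<le> 1"
    and \<psi>: "continuous_map X euclideanreal \<psi>" "\<And>y. y \<in> topspace X \<Longrightarrow> \<bar>\<psi> y\<bar> \<le> 1"
  shows "val (\<lambda>y\<in>topspace X. \<phi> y *\<^sub>R \<alpha> y) (\<lambda>y\<in>topspace X. \<psi> y *\<^sub>R \<beta> y) x
    = (\<phi> x * \<psi> x) *\<^sub>R val \<alpha> \<beta> x"
proof (rule lact_cancel, rule ract_cancel)
  fix c :: 'a and d :: 'b
  define \<gamma> where "\<gamma> = constant_near X x c"
  define \<delta> where "\<delta> = constant_near X x d"
  have \<gamma>: "\<gamma> \<in> carrier A\<^sub>0" "\<gamma> x = c" and \<delta>: "\<delta> \<in> carrier B\<^sub>0" "\<delta> x = d"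
    using x by (simp_all add: \<gamma>_def \<delta>_def near)
  note \<phi>\<alpha> = C0_scaleR[OF \<alpha> \<phi>] and \<psi>\<beta> = C0_scaleR[OF \<beta> \<psi>]
    and \<phi>\<gamma> = C0_scaleR[OF \<gamma>(1) \<phi>] and \<psi>\<delta> = C0_scaleR[OF \<delta>(1) \<psi>]
  \<comment> \<open>The scalar functions pass to the factors that are pulled out of \<open>q\<close>.\<close>
  have left: "mul A\<^sub>0 \<gamma> (\<lambda>y\<in>topspace X. \<phi> y *\<^sub>R \<alpha> y) = mul A\<^sub>0 (\<lambda>y\<in>topspace X. \<phi> y *\<^sub>R \<gamma> y) \<alpha>"
    and right: "mul B\<^sub>0 (\<lambda>y\<in>topspace X. \<psi> y *\<^sub>R \<beta> y) \<delta> = mul B\<^sub>0 \<beta> (\<lambda>y\<in>topspace X. \<psi> y *\<^sub>R \<delta> y)"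
    by auto
  have "ract V (lact V c (val (\<lambda>y\<in>topspace X. \<phi> y *\<^sub>R \<alpha> y) (\<lambda>y\<in>topspace X. \<psi> y *\<^sub>R \<beta> y) x)) d
      = val (mul A\<^sub>0 \<gamma> (\<lambda>y\<in>topspace X. \<phi> y *\<^sub>R \<alpha> y)) (mul B\<^sub>0 (\<lambda>y\<in>topspace X. \<psi> y *\<^sub>R \<beta> y) \<delta>) x"
    using val_linear(5)[OF \<phi>\<alpha> \<psi>\<beta> x \<gamma>(1) \<delta>(1)] \<gamma>(2) \<delta>(2) by (simp only: actions_commute)
  also have "\<dots> = lact V (\<phi> x *\<^sub>R c) (ract V (val \<alpha> \<beta> x) (\<psi> x *\<^sub>R d))"
    unfolding left right
    using val_linear(5)[OF \<alpha> \<beta> x \<phi>\<gamma> \<psi>\<delta>] \<gamma>(2) \<delta>(2) x by (simp only: restrict_apply' if_True)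
  also have "\<dots> = ract V (lact V c ((\<phi> x * \<psi> x) *\<^sub>R val \<alpha> \<beta> x)) d"
    by (simp add: scaleR_eq_scaleC lact_scaleC_left lact_scaleC_right ract_scaleC_right
        ract_scaleC_left actions_commute scaleC_scaleC mult.commute)
  finally show "ract V (lact V c (val (\<lambda>y\<in>topspace X. \<phi> y *\<^sub>R \<alpha> y) (\<lambda>y\<in>topspace X. \<psi> y *\<^sub>R \<beta> y) x)) d
      = ract V (lact V c ((\<phi> x * \<psi> x) *\<^sub>R val \<alpha> \<beta> x)) d" .
qed

text \<open>
  If \<open>\<alpha>(x) = 0\<close>, a cut-off with \<open>\<phi>(x) = 1\<close> gives
  \<open>q(\<alpha>, \<beta>)(x) = q(\<phi>\<alpha>, \<beta>)(x)\<close>, whose norm is at most a constant times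
  \<open>\<parallel>\<phi>\<alpha>\<parallel> \<le> \<epsilon>\<close>; likewise for \<open>\<beta>\<close>.
\<close>

lemma val_eq_zero:
  assumes \<alpha>: "\<alpha> \<in> carrier A\<^sub>0" and \<beta>: "\<beta> \<in> carrier B\<^sub>0" and x: "x \<in> topspace X"
    and zero: "\<alpha> x = 0 \<or> \<beta> x = 0"
  shows "val \<alpha> \<beta> x = 0"
proof -
  obtain K where K: "0 \<le> K" "\<And>\<alpha> \<beta> x. \<lbrakk>\<alpha> \<in> carrier A\<^sub>0; \<beta> \<in> carrier B\<^sub>0; x \<in> topspace X\<rbrakk> \<Longrightarrow>
    norm (val \<alpha> \<beta> x) \<le> K * nrm A\<^sub>0 \<alpha> * nrm B\<^sub>0 \<beta>"
    using val_bound by blast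
  have one: "continuous_map X euclideanreal (\<lambda>y. 1)" "\<bar>1 :: real\<bar> \<le> 1"
    by simp_all
  let ?C = "K * nrm A\<^sub>0 \<alpha> + K * nrm B\<^sub>0 \<beta>"
  have C: "0 \<le> K * nrm A\<^sub>0 \<alpha>" "0 \<le> K * nrm B\<^sub>0 \<beta>"
    using K(1) nrm_C0_nonneg[OF \<alpha>] nrm_C0_nonneg[OF \<beta>] by (simp_all del: C0_simps)
  have small: "norm (val \<alpha> \<beta> x) \<le> ?C * \<epsilon>" if \<epsilon>: "0 < \<epsilon>" for \<epsilon>
    using zero
  proof
    assume "\<alpha> x = 0"
    from cutoff_near_zero[OF \<alpha> this \<epsilon>] obtain \<phi> where \<phi>: "continuous_map X euclideanreal \<phi>"
      "\<And>y. y \<in> topspace X \<Longrightarrow> \<bar>\<phi> y\<bar> \<le> 1" "\<phi> x = 1"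
      "nrm A\<^sub>0 (\<lambda>y\<in>topspace X. \<phi> y *\<^sub>R \<alpha> y) \<le> \<epsilon>"
      by blast
    have "(\<lambda>y\<in>topspace X. 1 *\<^sub>R \<beta> y) = \<beta>"
      using \<beta> by (auto simp: carrier_C0_iff extensional_def)
    then have "val \<alpha> \<beta> x = val (\<lambda>y\<in>topspace X. \<phi> y *\<^sub>R \<alpha> y) \<beta> x"
      using val_scaleR[OF \<alpha> \<beta> x \<phi>(1,2) one] \<phi>(3) by simp
    also have "norm \<dots> \<le> K * nrm A\<^sub>0 (\<lambda>y\<in>topspace X. \<phi> y *\<^sub>R \<alpha> y) * nrm B\<^sub>0 \<beta>"
      by (rule K(2)[OF C0_scaleR[OF \<alpha> \<phi>(1,2)] \<beta> x])
    also have "\<dots> \<le> K * \<epsilon> * nrm B\<^sub>0 \<beta>"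
      using K(1) \<phi>(4) nrm_C0_nonneg[OF \<beta>] by (intro mult_right_mono mult_left_mono)
    also have "\<dots> = K * nrm B\<^sub>0 \<beta> * \<epsilon>"
      by (simp only: mult_ac)
    also have "\<dots> \<le> ?C * \<epsilon>"
      using C \<epsilon> by (intro mult_right_mono) (simp_all del: C0_simps)
    finally show ?thesis .
  next
    assume "\<beta> x = 0"
    from cutoff_near_zero[OF \<beta> this \<epsilon>] obtain \<psi> where \<psi>: "continuous_map X euclideanreal \<psi>"
      "\<And>y. y \<in> topspace X \<Longrightarrow> \<bar>\<psi> y\<bar> \<le> 1" "\<psi> x = 1"
      "nrm B\<^sub>0 (\<lambda>y\<in>topspace X. \<psi> y *\<^sub>R \<beta> y) \<le> \<epsilon>"
      by blast
    have "(\<lambda>y\<in>topspace X. 1 *\<^sub>R \<alpha> y) = \<alpha>"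
      using \<alpha> by (auto simp: carrier_C0_iff extensional_def)
    then have "val \<alpha> \<beta> x = val \<alpha> (\<lambda>y\<in>topspace X. \<psi> y *\<^sub>R \<beta> y) x"
      using val_scaleR[OF \<alpha> \<beta> x one \<psi>(1,2)] \<psi>(3) by simp
    also have "norm \<dots> \<le> K * nrm A\<^sub>0 \<alpha> * nrm B\<^sub>0 (\<lambda>y\<in>topspace X. \<psi> y *\<^sub>R \<beta> y)"
      by (rule K(2)[OF \<alpha> C0_scaleR[OF \<beta> \<psi>(1,2)] x])
    also have "\<dots> \<le> K * nrm A\<^sub>0 \<alpha> * \<epsilon>"
      using C(1) \<psi>(4) by (intro mult_left_mono)
    also have "\<dots> \<le> ?C * \<epsilon>"
      using C \<epsilon> by (intro mult_right_mono) (simp_all del: C0_simps)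
    finally show ?thesis .
  qed
  have "norm (val \<alpha> \<beta> x) \<le> 0 + e" if "0 < e" for e
  proof -
    have "norm (val \<alpha> \<beta> x) \<le> ?C * (e / (?C + 1))"
      using C that by (intro small divide_pos_pos) (simp_all del: C0_simps)
    also have "\<dots> \<le> e"
      using C that by (simp add: divide_simps del: C0_simps)
    finally show ?thesis by simp
  qed
  then show ?thesis
    using field_le_epsilon[of "norm (val \<alpha> \<beta> x)" 0] by simp
qed

text \<open>
  By bilinearity, \<open>val_eq_zero\<close> applied to differences shows that a quasi-multiplier acts fibrewise.
\<close>

lemma val_cong:
  assumes \<alpha>: "\<alpha> \<in> carrier A\<^sub>0" "\<alpha>' \<in> carrier A\<^sub>0" and \<beta>: "\<beta> \<in> carrier B\<^sub>0" "\<beta>' \<in> carrier B\<^sub>0"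
    and x: "x \<in> topspace X" and eq: "\<alpha> x = \<alpha>' x" "\<beta> x = \<beta>' x"
  shows "val \<alpha> \<beta> x = val \<alpha>' \<beta>' x"
proof -
  define \<alpha>d where "\<alpha>d = scl A\<^sub>0 (-1) \<alpha>'"
  define \<beta>d where "\<beta>d = scl B\<^sub>0 (-1) \<beta>'"
  have d: "\<alpha>d \<in> carrier A\<^sub>0" "\<beta>d \<in> carrier B\<^sub>0"
    unfolding \<alpha>d_def \<beta>d_def using \<alpha>(2) \<beta>(2) by (intro C0_scl; simp)+
  have "val (add A\<^sub>0 \<alpha> \<alpha>d) \<beta> x = 0"
    by (rule val_eq_zero[OF C0_add[OF \<alpha>(1) d(1)] \<beta>(1) x]) (simp add: \<alpha>d_def x eq)
  then have "val \<alpha> \<beta> x = val \<alpha>' \<beta> x"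
    using val_linear(1)[OF \<alpha>(1) \<beta>(1) x d(1)] val_linear(3)[OF \<alpha>(2) \<beta>(1) x, of "-1"]
    unfolding \<alpha>d_def by simp
  moreover have "val \<alpha>' (add B\<^sub>0 \<beta> \<beta>d) x = 0"
    by (rule val_eq_zero[OF \<alpha>(2) C0_add[OF \<beta>(1) d(2)] x]) (simp add: \<beta>d_def x eq)
  then have "val \<alpha>' \<beta> x = val \<alpha>' \<beta>' x"
    using val_linear(2)[OF \<alpha>(2) \<beta>(1) x d(2)] val_linear(4)[OF \<alpha>(2) \<beta>(2) x, of "-1"]
    unfolding \<beta>d_def by simp
  ultimately show ?thesis by simp
qed

lemma fibre_qm_eval:
  assumes "\<alpha> \<in> carrier A\<^sub>0" "\<beta> \<in> carrier B\<^sub>0" "x \<in> topspace X"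
  shows "fibre_qm q x (\<alpha> x, \<beta> x) = val \<alpha> \<beta> x"
  unfolding fibre_qm_def prod.case using assms by (intro val_cong) (simp_all add: near)

lemma fibre_qm_QMV:
  assumes x: "x \<in> topspace X"
  shows "fibre_qm q x \<in> QMV"
proof -
  let ?N = "constant_near X x"
  note N = near(1)[OF x] near(2)[OF x]
  obtain K where K: "0 \<le> K" "\<And>\<alpha> \<beta> x. \<lbrakk>\<alpha> \<in> carrier A\<^sub>0; \<beta> \<in> carrier B\<^sub>0; x \<in> topspace X\<rbrakk> \<Longrightarrow>
    norm (val \<alpha> \<beta> x) \<le> K * nrm A\<^sub>0 \<alpha> * nrm B\<^sub>0 \<beta>"
    using val_bound by blast
  have f: "fibre_qm q x (a, b) = val (?N a) (?N b) x" for a b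
    by (simp add: fibre_qm_def)
  have "fibre_qm q x (a + a', b) = fibre_qm q x (a, b) + fibre_qm q x (a', b)" for a a' b
    using fibre_qm_eval[OF C0_add[OF N(1)[of a] N(1)[of a']] N(1)[of b] x]
      val_linear(1)[OF N(1)[of a] N(1)[of b] x N(1)[of a']] by (simp add: f N x)
  moreover have "fibre_qm q x (a, b + b') = fibre_qm q x (a, b) + fibre_qm q x (a, b')" for a b b'
    using fibre_qm_eval[OF N(1)[of a] C0_add[OF N(1)[of b] N(1)[of b']] x]
      val_linear(2)[OF N(1)[of a] N(1)[of b] x N(1)[of b']] by (simp add: f N x)
  moreover have "fibre_qm q x (c *\<^sub>C a, b) = c *\<^sub>C fibre_qm q x (a, b)" for c a b
    using fibre_qm_eval[OF C0_scl[OF N(1)[of a]] N(1)[of b] x, of c]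
      val_linear(3)[OF N(1)[of a] N(1)[of b] x, of c] by (simp add: f N x)
  moreover have "fibre_qm q x (a, c *\<^sub>C b) = c *\<^sub>C fibre_qm q x (a, b)" for c a b
    using fibre_qm_eval[OF N(1)[of a] C0_scl[OF N(1)[of b]] x, of c]
      val_linear(4)[OF N(1)[of a] N(1)[of b] x, of c] by (simp add: f N x)
  moreover have "fibre_qm q x (c * a, b * d) = lact V c (ract V (fibre_qm q x (a, b)) d)" for a b c d
    using fibre_qm_eval[OF C0_mul[OF N(1)[of c] N(1)[of a]] C0_mul[OF N(1)[of b] N(1)[of d]] x]
      val_linear(5)[OF N(1)[of a] N(1)[of b] x N(1)[of c] N(1)[of d]] by (simp add: f N x)
  moreover have "norm (fibre_qm q x (a, b)) \<le> K * norm a * norm b" for a b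
  proof -
    have "norm (fibre_qm q x (a, b)) \<le> K * nrm A\<^sub>0 (?N a) * nrm B\<^sub>0 (?N b)"
      unfolding f by (rule K(2)[OF N(1) N(1) x])
    also have "\<dots> \<le> K * norm a * norm b"
      using K(1) nrm_constant_near[OF locally_compact Hausdorff_base x, of a]
        nrm_constant_near[OF locally_compact Hausdorff_base x, of b]
        nrm_C0_nonneg[OF N(1)[of a]] nrm_C0_nonneg[OF N(1)[of b]]
      by (intro mult_mono) (simp_all del: C0_simps)
    finally show ?thesis .
  qed
  ultimately show ?thesis
    unfolding QMV_iff by blast
qed

text \<open>
  Continuity at fixed \<open>(a, b)\<close>: near \<open>x\<close> the family is given by the single continuous section
  \<open>q(\<alpha>, \<beta>)\<close> with \<open>\<alpha> = a\<close> and \<open>\<beta> = b\<close> near \<open>x\<close>.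
\<close>

lemma fibre_qm_in_QM_families: "fibre_qm q \<in> QM_families"
  unfolding QM_families_def
proof (intro CollectI conjI ballI allI fibre_qm_QMV)
  fix a :: 'a and b :: 'b
  show "continuous_section (\<lambda>x. fibre_qm q x (a, b))"
    unfolding continuous_section_def
  proof (intro ballI)
    fix i x assume i: "i \<in> I" and x: "x \<in> U i"
    then have xX: "x \<in> topspace X" by (rule nbhd_topspace)
    let ?s = "val (constant_near X x a) (constant_near X x b)"
    obtain N where N: "openin X N" "x \<in> N"
      "\<And>y (c::'a). y \<in> N \<Longrightarrow> constant_near X x c y = c"
      using constant_near_eq[OF locally_compact Hausdorff_base xX] by blast
    obtain N' where N': "openin X N'" "x \<in> N'"
      "\<And>y (c::'b). y \<in> N' \<Longrightarrow> constant_near X x c y = c"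
      using constant_near_eq[OF locally_compact Hausdorff_base xX] by blast
    have eq: "fibre_qm q y (a, b) = ?s y" if "y \<in> N \<inter> N'" for y
    proof -
      have "y \<in> topspace X" using N(1) that openin_subset by blast
      from fibre_qm_eval[OF near(1)[OF xX, of a] near(1)[OF xX, of b] this] that
      show ?thesis by (simp add: N N')
    qed
    have "eventually (\<lambda>y. to_chart i y (?s y) = to_chart i y (fibre_qm q y (a, b))) (atin X x)"
      unfolding eventually_atin using N(1,2) N'(1,2) eq
      by (intro disjI2 exI[of _ "N \<inter> N'"]) (auto simp: openin_Int)
    moreover have "((\<lambda>y. to_chart i y (?s y)) \<longlongrightarrow> to_chart i x (?s x)) (atin X x)"
      using val_continuous(1)[OF near(1)[OF xX] near(1)[OF xX]] i x
      unfolding continuous_section_def by blast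
    ultimately have "((\<lambda>y. to_chart i y (fibre_qm q y (a, b))) \<longlongrightarrow> to_chart i x (?s x)) (atin X x)"
      by (rule Lim_transform_eventually[rotated])
    then show "((\<lambda>y. to_chart i y (fibre_qm q y (a, b))) \<longlongrightarrow> to_chart i x (fibre_qm q x (a, b))) (atin X x)"
      using eq[of x] N(2) N'(2) by simp
  qed
next
  obtain K where K: "0 \<le> K" "\<And>\<alpha> \<beta> x. \<lbrakk>\<alpha> \<in> carrier A\<^sub>0; \<beta> \<in> carrier B\<^sub>0; x \<in> topspace X\<rbrakk> \<Longrightarrow>
    norm (val \<alpha> \<beta> x) \<le> K * nrm A\<^sub>0 \<alpha> * nrm B\<^sub>0 \<beta>"
    using val_bound by blast
  have "QM_norm (fibre_qm q x) \<le> K" if x: "x \<in> topspace X" for x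
  proof (rule nrm_QMV_least)
    fix a :: 'a and b :: 'b assume ab: "norm a \<le> 1" "norm b \<le> 1"
    have "norm (fibre_qm q x (a, b)) \<le> K * nrm A\<^sub>0 (constant_near X x a) * nrm B\<^sub>0 (constant_near X x b)"
      unfolding fibre_qm_def prod.case by (rule K(2)[OF near(1)[OF x] near(1)[OF x] x])
    also have "\<dots> \<le> K * 1 * 1"
      using K(1) nrm_C0_nonneg[OF near(1)[OF x, of a]] nrm_C0_nonneg[OF near(1)[OF x, of b]]
        order_trans[OF nrm_constant_near[OF locally_compact Hausdorff_base x] ab(1)]
        order_trans[OF nrm_constant_near[OF locally_compact Hausdorff_base x] ab(2)]
      by (intro mult_mono) (simp_all del: C0_simps)
    finally show "norm (fibre_qm q x (a, b)) \<le> K" by simp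
  qed
  then show "\<exists>K. \<forall>x\<in>topspace X. QM_norm (fibre_qm q x) \<le> K" by blast
qed

lemma qm_of_fibre_qm: "qm_of (fibre_qm q) = q"
proof (rule extensionalityI[where A = "carrier A\<^sub>0 \<times> carrier B\<^sub>0"])
  fix z assume z: "z \<in> carrier A\<^sub>0 \<times> carrier B\<^sub>0"
  then obtain \<alpha> \<beta> where z: "z = (\<alpha>, \<beta>)" "\<alpha> \<in> carrier A\<^sub>0" "\<beta> \<in> carrier B\<^sub>0" by blast
  have "section_of (\<lambda>x. fibre_qm q x (\<alpha> x, \<beta> x)) = section_of (val \<alpha> \<beta>)"
    using z by (intro section_of_cong fibre_qm_eval)
  then show "qm_of (fibre_qm q) z = q z"
    using z q_section(2) by (simp add: qm_of_apply)
qed (use quasi_multipliersD(2)[OF q] in \<open>auto simp: qm_of_def\<close>)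

end

lemma quasi_multipliers_C0_sections: "quasi_multipliers A\<^sub>0 B\<^sub>0 V\<^sub>0 = qm_of ` QM_families"
proof (intro equalityI subsetI)
  fix q assume q: "q \<in> quasi_multipliers A\<^sub>0 B\<^sub>0 V\<^sub>0"
  have "qm_of (fibre_qm q) \<in> qm_of ` QM_families"
    by (rule imageI[OF fibre_qm_in_QM_families[OF q]])
  then show "q \<in> qm_of ` QM_families"
    by (simp only: qm_of_fibre_qm[OF q])
qed (auto simp: qm_of_in_QM)

section \<open>The isomorphism\<close>

lemma QM_C0_sections_simps:
  "add (QM A\<^sub>0 B\<^sub>0 V\<^sub>0) (qm_of r) (qm_of s) = qm_of (\<lambda>x. add QM\<^sub>V (r x) (s x))"
  "scl (QM A\<^sub>0 B\<^sub>0 V\<^sub>0) c (qm_of r) = qm_of (\<lambda>x. scl QM\<^sub>V c (r x))"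
  "\<alpha> \<in> carrier A\<^sub>0 \<Longrightarrow> lact (QM A\<^sub>0 B\<^sub>0 V\<^sub>0) \<alpha> (qm_of r) = qm_of (\<lambda>x. lact QM\<^sub>V (\<alpha> x) (r x))"
  "\<beta> \<in> carrier B\<^sub>0 \<Longrightarrow> ract (QM A\<^sub>0 B\<^sub>0 V\<^sub>0) (qm_of r) \<beta> = qm_of (\<lambda>x. ract QM\<^sub>V (r x) (\<beta> x))"
proof -
  show "add (QM A\<^sub>0 B\<^sub>0 V\<^sub>0) (qm_of r) (qm_of s) = qm_of (\<lambda>x. add QM\<^sub>V (r x) (s x))"
    unfolding QM_V_simps by (auto simp: QM_def qm_of_def C0_sections_simps intro!: restrict_ext)
  show "scl (QM A\<^sub>0 B\<^sub>0 V\<^sub>0) c (qm_of r) = qm_of (\<lambda>x. scl QM\<^sub>V c (r x))"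
    unfolding QM_V_simps by (auto simp: QM_def qm_of_def C0_sections_simps intro!: restrict_ext)
  show "lact (QM A\<^sub>0 B\<^sub>0 V\<^sub>0) \<alpha> (qm_of r) = qm_of (\<lambda>x. lact QM\<^sub>V (\<alpha> x) (r x))" if "\<alpha> \<in> carrier A\<^sub>0"
    unfolding QM_V_simps using C0_mul[OF _ that]
    by (auto simp: QM_def qm_of_def intro!: restrict_ext section_of_cong)
  show "ract (QM A\<^sub>0 B\<^sub>0 V\<^sub>0) (qm_of r) \<beta> = qm_of (\<lambda>x. ract QM\<^sub>V (r x) (\<beta> x))" if "\<beta> \<in> carrier B\<^sub>0"
    unfolding QM_V_simps using C0_mul[OF that]
    by (auto simp: QM_def qm_of_def intro!: restrict_ext section_of_cong)
qed

text \<open>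
  For \<open>\<le>\<close>, the values of functions in the unit ball lie in the unit ball of the fibre; for
  \<open>\<ge>\<close>, every pair in the unit balls is the value of a pair of functions in the unit balls.
\<close>

lemma nrm_qm_of:
  assumes r: "r \<in> QM_families"
  shows "nrm (QM A\<^sub>0 B\<^sub>0 V\<^sub>0) (qm_of r) = sup_over X (\<lambda>x. QM_norm (r x))"
proof (rule antisym)
  have rD: "r x \<in> QMV" if "x \<in> topspace X" for x
    using r that by (simp add: QM_families_def)
  obtain K where K: "\<And>x. x \<in> topspace X \<Longrightarrow> QM_norm (r x) \<le> K"
    using r unfolding QM_families_def by blast
  have zero: "\<exists>f\<in>carrier (C0 X). nrm (C0 X) (f :: 'x \<Rightarrow> 'c::cstar_algebra) \<le> 1"
    by (intro bexI[of _ "\<lambda>x\<in>topspace X. 0"] restrict_in_C0I)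
      (auto simp: sup_over_def vanishes_at_infinity_def intro!: cSup_least exI[of _ "{}"])
  show "nrm (QM A\<^sub>0 B\<^sub>0 V\<^sub>0) (qm_of r) \<le> sup_over X (\<lambda>x. QM_norm (r x))"
  proof (rule nrm_QM_least[OF zero zero])
    fix \<alpha> \<beta> assume \<alpha>: "\<alpha> \<in> carrier A\<^sub>0" "nrm A\<^sub>0 \<alpha> \<le> 1" and \<beta>: "\<beta> \<in> carrier B\<^sub>0" "nrm B\<^sub>0 \<beta> \<le> 1"
    show "nrm V\<^sub>0 (qm_of r (\<alpha>, \<beta>)) \<le> sup_over X (\<lambda>x. QM_norm (r x))"
      unfolding qm_of_apply[OF \<alpha>(1) \<beta>(1)] nrm_C0_sections[OF qm_of_in_sections[OF r \<alpha>(1) \<beta>(1)]]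
    proof (rule sup_over_least)
      show "0 \<le> sup_over X (\<lambda>x. QM_norm (r x))"
        using K by (rule sup_over_upper)
      fix x assume x: "x \<in> topspace X"
      have "norm (\<alpha> x) \<le> 1" "norm (\<beta> x) \<le> 1"
        using norm_le_nrm_C0[OF \<alpha>(1) x] norm_le_nrm_C0[OF \<beta>(1) x] \<alpha>(2) \<beta>(2) by linarith+
      then have "norm (r x (\<alpha> x, \<beta> x)) \<le> QM_norm (r x)"
        by (rule norm_le_nrm_QMV[OF rD[OF x]])
      also have "\<dots> \<le> sup_over X (\<lambda>x. QM_norm (r x))"
        using K x by (rule sup_over_upper)
      finally show "norm (r x (\<alpha> x, \<beta> x)) \<le> sup_over X (\<lambda>x. QM_norm (r x))" .
    qed
  qed
  let ?N = "nrm (QM A\<^sub>0 B\<^sub>0 V\<^sub>0) (qm_of r)"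
  obtain L where L: "\<And>\<alpha> \<beta>. \<lbrakk>\<alpha> \<in> carrier A\<^sub>0; \<beta> \<in> carrier B\<^sub>0\<rbrakk> \<Longrightarrow>
      nrm V\<^sub>0 (qm_of r (\<alpha>, \<beta>)) \<le> L * nrm A\<^sub>0 \<alpha> * nrm B\<^sub>0 \<beta>"
    using quasi_multipliersD(7)[OF qm_of_in_QM[OF r]] by blast
  have upper: "nrm V\<^sub>0 (section_of (\<lambda>x. r x (\<alpha> x, \<beta> x))) \<le> ?N"
    if \<alpha>: "\<alpha> \<in> carrier A\<^sub>0" "nrm A\<^sub>0 \<alpha> \<le> 1" and \<beta>: "\<beta> \<in> carrier B\<^sub>0" "nrm B\<^sub>0 \<beta> \<le> 1" for \<alpha> \<beta>
    using nrm_QM_upper[OF L nrm_C0_nonneg nrm_C0_nonneg \<alpha> \<beta>]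
    unfolding qm_of_apply[OF \<alpha>(1) \<beta>(1)] .
  show "sup_over X (\<lambda>x. QM_norm (r x)) \<le> ?N"
  proof (rule sup_over_least)
    obtain \<alpha> where \<alpha>: "\<alpha> \<in> carrier A\<^sub>0" "nrm A\<^sub>0 \<alpha> \<le> 1"
      using zero by blast
    obtain \<beta> where \<beta>: "\<beta> \<in> carrier B\<^sub>0" "nrm B\<^sub>0 \<beta> \<le> 1"
      using zero by blast
    show "0 \<le> ?N"
      using norm_le_nrm_C0_sections(2)[OF qm_of_in_sections[OF r \<alpha>(1) \<beta>(1)]] upper[OF \<alpha> \<beta>]
      by (rule order_trans)
    fix x assume x: "x \<in> topspace X"
    show "QM_norm (r x) \<le> ?N"
    proof (rule nrm_QMV_least)
      fix a :: 'a and b :: 'b assume ab: "norm a \<le> 1" "norm b \<le> 1"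
      note a = near(1)[OF x, of a] order_trans[OF nrm_constant_near[OF locally_compact Hausdorff_base x] ab(1)]
        and b = near(1)[OF x, of b] order_trans[OF nrm_constant_near[OF locally_compact Hausdorff_base x] ab(2)]
      show "norm (r x (a, b)) \<le> ?N"
        using order_trans[OF norm_le_nrm_C0_sections(1)[OF qm_of_in_sections[OF r a(1) b(1)] x] upper[OF a b]]
        by (simp only: near(2)[OF x])
    qed
  qed
qed

lemma isometric_bimodule_iso_sections:
  "isometric_bimodule_iso A\<^sub>0 B\<^sub>0 (QM A\<^sub>0 B\<^sub>0 V\<^sub>0) (Cb_QM_sections V E) (\<lambda>q. QM_section (fibre_qm q))"
  (is "isometric_bimodule_iso _ _ ?M ?N _")
proof -
  have \<Phi>: "QM_section (fibre_qm (qm_of r)) = QM_section r" for r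
    by (simp add: QM_section_def fibre_qm_qm_of cong: restrict_cong)
  have rD: "r x \<in> QMV" if "r \<in> QM_families" "x \<in> topspace X" for r x
    using that by (simp add: QM_families_def)
  have inj: "qm_of r = qm_of s"
    if r: "r \<in> QM_families" and s: "s \<in> QM_families" and eq: "QM_section r = QM_section s" for r s
  proof (rule qm_of_cong)
    fix x assume x: "x \<in> topspace X"
    have "QM_point x (r x) = QM_point x (s x)"
      using fun_cong[OF eq, of x] x by (simp add: QM_section_apply)
    then show "r x = s x"
      by (rule QM_point_inj[OF x rD[OF r x] rD[OF s x]])
  qed
  have "inj_on (\<lambda>q. QM_section (fibre_qm q)) (qm_of ` QM_families)"
  proof (rule inj_onI)
    fix q q' assume "q \<in> qm_of ` QM_families" "q' \<in> qm_of ` QM_families"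
      and eq: "QM_section (fibre_qm q) = QM_section (fibre_qm q')"
    then obtain r s where r: "r \<in> QM_families" "q = qm_of r" and s: "s \<in> QM_families" "q' = qm_of s"
      by blast
    show "q = q'"
      unfolding r(2) s(2) by (rule inj[OF r(1) s(1)]) (use eq in \<open>simp only: r(2) s(2) \<Phi>\<close>)
  qed
  then have "bij_betw (\<lambda>q. QM_section (fibre_qm q)) (qm_of ` QM_families) (QM_section ` QM_families)"
    by (simp add: bij_betw_def image_image \<Phi>)
  moreover have "QM_section (fibre_qm (add ?M (qm_of r) (qm_of s))) =
      add ?N (QM_section (fibre_qm (qm_of r))) (QM_section (fibre_qm (qm_of s)))"
    if "r \<in> QM_families" "s \<in> QM_families" for r s
    unfolding QM_C0_sections_simps \<Phi> using that by (intro Cb_QM_sections_simps(1)[symmetric] rD)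
  moreover have "QM_section (fibre_qm (scl ?M c (qm_of r))) = scl ?N c (QM_section (fibre_qm (qm_of r)))"
    "nrm ?N (QM_section (fibre_qm (qm_of r))) = nrm ?M (qm_of r)"
    "\<alpha> \<in> carrier A\<^sub>0 \<Longrightarrow> QM_section (fibre_qm (lact ?M \<alpha> (qm_of r))) = lact ?N \<alpha> (QM_section (fibre_qm (qm_of r)))"
    "\<beta> \<in> carrier B\<^sub>0 \<Longrightarrow> QM_section (fibre_qm (ract ?M (qm_of r) \<beta>)) = ract ?N (QM_section (fibre_qm (qm_of r))) \<beta>"
    if r: "r \<in> QM_families" for r c \<alpha> \<beta>
    using Cb_QM_sections_simps(2-5)[of r r, OF rD[OF r] rD[OF r]]
    by (simp_all only: QM_C0_sections_simps nrm_qm_of[OF r] \<Phi>)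
  ultimately show ?thesis
    unfolding isometric_bimodule_iso_def carrier_QM quasi_multipliers_C0_sections carrier_Cb_QM_sections
    by blast
qed

end

theorem theorem5p4:
  fixes X :: "'x topology"
    and V :: "('a::cstar_algebra, 'b::cstar_algebra, 'v::complex_banach) hbimodule"
    and E :: "('i, 'x, 'e, 'v) fibre_bundle"
  assumes "locally_compact_space X" and "Hausdorff_space X"
    and "hilbert_bimodule V"
    and "hilbert_bimodule_bundle V E" and "base_space E = X"
  shows "\<exists>\<Phi>. isometric_bimodule_iso (C0 X) (C0 X)
                (QM (C0 X) (C0 X) (C0_sections V E)) (Cb_QM_sections V E) \<Phi>"
proof -
  interpret hilbert_bimodule_bundle V E by fact
  interpret hilbert_bimodule_bundle_lch V E
    using assms by unfold_locales simp_all
  show ?thesis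
    using isometric_bimodule_iso_sections unfolding assms(5) by blast
qed

end
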